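(* Let $\Delta$ be a finite connected graph, let $G\le\operatorname{Aut}(\Delta)$, and suppose that $\Delta$ is $G$-vertex-transitive and $G$-locally semiprimitive. Let $(x,y)$ be an arc of $\Delta$. Then there is a prime $p$ such that $G_{x,y}^{[1]}$ is a $p$-group and, furthermore, either $F^*(G_{x,y})$ is a $p$-group or $G_{x,y}^{[1]}=1$.
   Context: Graphs are undirected, and an arc is an ordered pair of adjacent vertices. $\Delta$ is $G$-vertex-transitive if $G$ acts transitively on the vertices of $\Delta$. For a vertex $z$, $\Delta(z)$ is the set of vertices adjacent to $z$, $G_z$ is the stabiliser of $z$ in $G$, and $G_z^{[1]}$ is the subgroup of $G_z$ fixing $\Delta(z)$ pointwise. For an arc $(x,y)$, $G_{x,y}=G_x\cap G_y$ and $G_{x,y}^{[1]}=G_x^{[1]}\cap G_y^{[1]}$. A finite permutation group is semiregular if the identity is its only element fixing some point, and it is semiprimitive if each of its normal subgroups is either transitive or semiregular. $\Delta$ is $G$-locally semiprimitive if for every vertex $z$ the permutation group $G_z^{\Delta(z)}$ induced by $G_z$ on $\Delta(z)$ is semiprimitive. $F^*(A)$ is the generalised Fitting subgroup of $A$. The trivial group is a $p$-group for every prime $p$. *)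

theory Defs
  imports
    "HOL-Algebra.Group_Action"
    "HOL-Algebra.Generated_Groups"
    "HOL-Algebra.SimpleGroups"
    "Graph_Theory.Digraph_Component"
begin

section \<open>Finite groups\<close>

definition p_group :: "nat \<Rightarrow> ('a, 'b) monoid_scheme \<Rightarrow> bool" where
  "p_group p A \<longleftrightarrow> group A \<and> (\<exists>n. order A = p ^ n)"

primrec lower_central :: "('a, 'b) monoid_scheme \<Rightarrow> nat \<Rightarrow> 'a set" where
  "lower_central A 0 = carrier A"
| "lower_central A (Suc n) = generate A
     (\<Union>h \<in> lower_central A n. \<Union>a \<in> carrier A.
       {h \<otimes>\<^bsub>A\<^esub> a \<otimes>\<^bsub>A\<^esub> inv\<^bsub>A\<^esub> h \<otimes>\<^bsub>A\<^esub> inv\<^bsub>A\<^esub> a})"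

definition nilpotent_group :: "('a, 'b) monoid_scheme \<Rightarrow> bool" where
  "nilpotent_group A \<longleftrightarrow> group A \<and> (\<exists>n. lower_central A n = {\<one>\<^bsub>A\<^esub>})"

definition group_center :: "('a, 'b) monoid_scheme \<Rightarrow> 'a set" where
  "group_center A = {z \<in> carrier A. \<forall>a \<in> carrier A. z \<otimes>\<^bsub>A\<^esub> a = a \<otimes>\<^bsub>A\<^esub> z}"

text \<open>The library's \<^const>\<open>simple_group\<close> asks for \<^term>\<open>order A > 1\<close>, so quasisimple groups
  have finite central quotient here. All groups considered below are finite.\<close>

definition quasisimple_group :: "('a, 'b) monoid_scheme \<Rightarrow> bool" where
  "quasisimple_group A \<longleftrightarrow>
     group A \<and> derived A (carrier A) = carrier A \<and> simple_group (A Mod group_center A)"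

inductive subnormal :: "('a, 'b) monoid_scheme \<Rightarrow> 'a set \<Rightarrow> bool" for A where
  whole: "subnormal A (carrier A)"
| step: "\<lbrakk>subnormal A K; H \<lhd> A\<lparr>carrier := K\<rparr>\<rbrakk> \<Longrightarrow> subnormal A H"

definition group_component :: "('a, 'b) monoid_scheme \<Rightarrow> 'a set \<Rightarrow> bool" where
  "group_component A C \<longleftrightarrow> subnormal A C \<and> quasisimple_group (A\<lparr>carrier := C\<rparr>)"

text \<open>For a finite group, the join of all nilpotent normal subgroups is the largest nilpotent
  normal subgroup.\<close>

definition fitting_subgroup :: "('a, 'b) monoid_scheme \<Rightarrow> 'a set" where
  "fitting_subgroup A = generate A (\<Union>{N. N \<lhd> A \<and> nilpotent_group (A\<lparr>carrier := N\<rparr>)})"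

definition layer :: "('a, 'b) monoid_scheme \<Rightarrow> 'a set" where
  "layer A = generate A (\<Union>{C. group_component A C})"

definition generalised_fitting_subgroup :: "('a, 'b) monoid_scheme \<Rightarrow> 'a set" where
  "generalised_fitting_subgroup A = fitting_subgroup A <#>\<^bsub>A\<^esub> layer A"


section \<open>Permutation groups\<close>

text \<open>Permutations of \<open>\<Omega>\<close> are the elements of \<^term>\<open>Bij \<Omega>\<close>, that is, they are \<^const>\<open>undefined\<close>
  outside \<open>\<Omega>\<close>; a permutation group on \<open>\<Omega>\<close> is a subgroup of \<^term>\<open>BijGroup \<Omega>\<close>.\<close>

abbreviation perm_group :: "'a set \<Rightarrow> ('a \<Rightarrow> 'a) set \<Rightarrow> ('a \<Rightarrow> 'a) monoid" where
  "perm_group \<Omega> H \<equiv> (BijGroup \<Omega>)\<lparr>carrier := H\<rparr>"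

definition transitive_perm :: "'a set \<Rightarrow> ('a \<Rightarrow> 'a) set \<Rightarrow> bool" where
  "transitive_perm \<Omega> H \<longleftrightarrow> transitive_action (perm_group \<Omega> H) \<Omega> (\<lambda>g. g)"

definition semiregular_perm :: "'a set \<Rightarrow> ('a \<Rightarrow> 'a) set \<Rightarrow> bool" where
  "semiregular_perm \<Omega> H \<longleftrightarrow>
     (\<forall>g \<in> H. (\<exists>\<omega> \<in> \<Omega>. g \<omega> = \<omega>) \<longrightarrow> g = \<one>\<^bsub>BijGroup \<Omega>\<^esub>)"

definition semiprimitive_perm :: "'a set \<Rightarrow> ('a \<Rightarrow> 'a) set \<Rightarrow> bool" where
  "semiprimitive_perm \<Omega> H \<longleftrightarrow>
     (\<forall>N. N \<lhd> perm_group \<Omega> H \<longrightarrow> transitive_perm \<Omega> N \<or> semiregular_perm \<Omega> N)"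


section \<open>Groups of graph automorphisms\<close>

text \<open>A finite simple undirected graph is a \<^locale>\<open>pair_graph\<close>: its arc set
  \<^const>\<open>parcs\<close> is a symmetric irreflexive relation on the finite vertex set \<^const>\<open>pverts\<close>.\<close>

definition graph_auto :: "'a pair_pre_digraph \<Rightarrow> ('a \<Rightarrow> 'a) set" where
  "graph_auto D = {g \<in> Bij (pverts D). \<forall>u \<in> pverts D. \<forall>v \<in> pverts D.
     (g u, g v) \<in> parcs D \<longleftrightarrow> (u, v) \<in> parcs D}"

definition graph_AutoGroup :: "'a pair_pre_digraph \<Rightarrow> ('a \<Rightarrow> 'a) monoid" where
  "graph_AutoGroup D = perm_group (pverts D) (graph_auto D)"

definition neighbours :: "'a pair_pre_digraph \<Rightarrow> 'a \<Rightarrow> 'a set" where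
  "neighbours D z = {w. (z, w) \<in> parcs D}"

definition vertex_stabilizer :: "'a pair_pre_digraph \<Rightarrow> ('a \<Rightarrow> 'a) set \<Rightarrow> 'a \<Rightarrow> ('a \<Rightarrow> 'a) set" where
  "vertex_stabilizer D G z = stabilizer (perm_group (pverts D) G) (\<lambda>g. g) z"

definition vertex_kernel :: "'a pair_pre_digraph \<Rightarrow> ('a \<Rightarrow> 'a) set \<Rightarrow> 'a \<Rightarrow> ('a \<Rightarrow> 'a) set" where
  "vertex_kernel D G z = {g \<in> vertex_stabilizer D G z. \<forall>w \<in> neighbours D z. g w = w}"

definition arc_stabilizer :: "'a pair_pre_digraph \<Rightarrow> ('a \<Rightarrow> 'a) set \<Rightarrow> 'a \<Rightarrow> 'a \<Rightarrow> ('a \<Rightarrow> 'a) set" where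
  "arc_stabilizer D G x y = vertex_stabilizer D G x \<inter> vertex_stabilizer D G y"

definition arc_kernel :: "'a pair_pre_digraph \<Rightarrow> ('a \<Rightarrow> 'a) set \<Rightarrow> 'a \<Rightarrow> 'a \<Rightarrow> ('a \<Rightarrow> 'a) set" where
  "arc_kernel D G x y = vertex_kernel D G x \<inter> vertex_kernel D G y"

definition local_action :: "'a pair_pre_digraph \<Rightarrow> ('a \<Rightarrow> 'a) set \<Rightarrow> 'a \<Rightarrow> ('a \<Rightarrow> 'a) set" where
  "local_action D G z = (\<lambda>g. restrict g (neighbours D z)) ` vertex_stabilizer D G z"

definition vertex_transitive :: "'a pair_pre_digraph \<Rightarrow> ('a \<Rightarrow> 'a) set \<Rightarrow> bool" where
  "vertex_transitive D G \<longleftrightarrow> transitive_perm (pverts D) G"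

definition locally_semiprimitive :: "'a pair_pre_digraph \<Rightarrow> ('a \<Rightarrow> 'a) set \<Rightarrow> bool" where
  "locally_semiprimitive D G \<longleftrightarrow>
     (\<forall>z \<in> pverts D. semiprimitive_perm (neighbours D z) (local_action D G z))"

end

theory Submission
  imports Defs "HOL-Algebra.Sylow" "HOL-Algebra.Multiplicative_Group"
begin

text \<open>
  Write \<open>Q = G\<^sub>x\<^sup>[\<^sup>1\<^sup>]\<close>, \<open>R = G\<^sub>y\<^sup>[\<^sup>1\<^sup>]\<close>, \<open>B = G\<^sub>x\<^sub>y\<close> and \<open>K = Q \<inter> R\<close>. If no local action is
  transitive, they are all semiregular and \<open>K\<close> fixes everything. Otherwise some element reverses the
  arc, a normal subgroup of \<open>G\<^sub>x\<close> meeting \<open>G\<^sub>y\<close> outside \<open>Q\<close> is transitive on the neighbours of \<open>x\<close>,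
  and a subset of \<open>B\<close> normalised by such subgroups of both \<open>G\<^sub>x\<close> and \<open>G\<^sub>y\<close> is trivial, because they
  generate an edge-transitive group. Let \<open>K \<noteq> 1\<close>.

  The centralisers of \<open>Q\<close> in \<open>G\<^sub>x\<close> and of \<open>R\<close> in \<open>G\<^sub>y\<close> both centralise \<open>K\<close>, so they cannot both be
  transitive and \<open>C\<^sub>B(Q) \<le> Q\<close>. A component of \<open>B\<close> lies in \<open>Q\<close> or centralises \<open>Q\<close>; hence \<open>B\<close>, \<open>Q\<close> and
  \<open>R\<close> have the same components, and there are none. If \<open>O\<^sub>p(Q) \<noteq> 1\<close>, then \<open>O\<^sub>p(Q)\<close> is not contained in
  \<open>R\<close> but centralises \<open>O\<^sub>q(R)\<close> for \<open>q \<noteq> p\<close>, so the centraliser of \<open>O\<^sub>q(R)\<close> in \<open>G\<^sub>y\<close> is transitive, and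
  likewise at \<open>x\<close>; hence \<open>O\<^sub>q(K) = 1\<close>. So \<open>p\<close> is unique, and \<open>O\<^sub>q(B)\<close>, which centralises \<open>Q\<close>, is trivial.
  Finally \<open>O\<^sub>p(Q)\<close> normalises the \<open>p'\<close>-elements of every conjugate of \<open>K\<close> under \<open>G\<^sub>y\<close>, since these
  conjugates are subnormal in \<open>B\<close>; so the \<open>p'\<close>-elements of \<open>K\<close> are normalised by transitive normal
  subgroups of \<open>G\<^sub>x\<close> and \<open>G\<^sub>y\<close>, and \<open>K\<close> is a \<open>p\<close>-group.
\<close>

section \<open>Conjugation, normality and p-cores\<close>

context group
begin

definition conj_by :: "'a \<Rightarrow> 'a \<Rightarrow> 'a" where
  "conj_by g h = g \<otimes> h \<otimes> inv g"

lemma inv_mult_cancel_left: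
  assumes "a \<in> carrier G" "b \<in> carrier G"
  shows "inv a \<otimes> (a \<otimes> b) = b" "a \<otimes> (inv a \<otimes> b) = b"
  using assms by (simp_all flip: m_assoc)

lemmas group_word_simps = m_assoc inv_mult_group inv_mult_cancel_left

lemma conj_by_closed [simp, intro]:
  "g \<in> carrier G \<Longrightarrow> h \<in> carrier G \<Longrightarrow> conj_by g h \<in> carrier G"
  by (simp add: conj_by_def)

lemma conj_by_one [simp]: "h \<in> carrier G \<Longrightarrow> conj_by \<one> h = h"
  by (simp add: conj_by_def)

lemma conj_by_comp:
  "\<lbrakk>g \<in> carrier G; h \<in> carrier G; a \<in> carrier G\<rbrakk> \<Longrightarrow> conj_by (g \<otimes> h) a = conj_by g (conj_by h a)"
  by (simp add: conj_by_def group_word_simps)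

lemma conj_by_inv_cancel [simp]:
  assumes "g \<in> carrier G" "a \<in> carrier G"
  shows "conj_by g (conj_by (inv g) a) = a" "conj_by (inv g) (conj_by g a) = a"
  using assms by (simp_all flip: conj_by_comp)

lemma conj_by_hom: "g \<in> carrier G \<Longrightarrow> group_hom G G (conj_by g)"
  by unfold_locales (auto simp: hom_def conj_by_def group_word_simps)

lemma conj_by_mult:
  "\<lbrakk>g \<in> carrier G; a \<in> carrier G; b \<in> carrier G\<rbrakk>
    \<Longrightarrow> conj_by g (a \<otimes> b) = conj_by g a \<otimes> conj_by g b"
  by (rule group_hom.hom_mult[OF conj_by_hom])

lemma conj_by_inv:
  "\<lbrakk>g \<in> carrier G; a \<in> carrier G\<rbrakk> \<Longrightarrow> conj_by g (inv a) = inv (conj_by g a)"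
  by (rule group_hom.hom_inv[OF conj_by_hom])

lemma conj_by_self_one [simp]: "g \<in> carrier G \<Longrightarrow> conj_by g \<one> = \<one>"
  by (simp add: conj_by_def)

lemma conj_by_nat_pow:
  "\<lbrakk>g \<in> carrier G; a \<in> carrier G\<rbrakk> \<Longrightarrow> conj_by g (a [^] (n::nat)) = conj_by g a [^] n"
  by (rule group_hom.hom_nat_pow[OF conj_by_hom])

lemma conj_by_eq_one_iff [simp]:
  assumes "g \<in> carrier G" "a \<in> carrier G"
  shows "conj_by g a = \<one> \<longleftrightarrow> a = \<one>"
  using assms by (metis conj_by_inv_cancel(2) conj_by_self_one inv_closed)

lemma conj_by_eq_self_iff:
  "\<lbrakk>g \<in> carrier G; a \<in> carrier G\<rbrakk> \<Longrightarrow> conj_by g a = a \<longleftrightarrow> g \<otimes> a = a \<otimes> g"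
  by (simp add: conj_by_def inv_solve_right')

lemma conj_by_image_inv_cancel:
  assumes "g \<in> carrier G" "S \<subseteq> carrier G"
  shows "conj_by (inv g) ` conj_by g ` S = S" "conj_by g ` conj_by (inv g) ` S = S"
  using assms by (auto simp: image_image subset_iff cong: image_cong)

lemma subgroup_conj_by:
  "\<lbrakk>g \<in> carrier G; subgroup H G\<rbrakk> \<Longrightarrow> subgroup (conj_by g ` H) G"
  by (rule group_hom.subgroup_img_is_subgroup[OF conj_by_hom])

text \<open>All subgroups stay subsets of one ambient group, so conjugation, products and powers
  keep a single meaning; \<open>normal_in_iff_normal\<close> translates to normality in the
  restricted structure.\<close>

definition normal_in :: "'a set \<Rightarrow> 'a set \<Rightarrow> bool" where
  "normal_in H K \<longleftrightarrow> subgroup H G \<and> subgroup K G \<and> H \<subseteq> K \<and> (\<forall>k\<in>K. \<forall>h\<in>H. conj_by k h \<in> H)"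

lemma normal_inI:
  "\<lbrakk>subgroup H G; subgroup K G; H \<subseteq> K; \<And>k h. k \<in> K \<Longrightarrow> h \<in> H \<Longrightarrow> conj_by k h \<in> H\<rbrakk>
    \<Longrightarrow> normal_in H K"
  by (simp add: normal_in_def)

lemma normal_inD:
  assumes "normal_in H K"
  shows "subgroup H G" "subgroup K G" "H \<subseteq> K" "H \<subseteq> carrier G" "K \<subseteq> carrier G"
    "k \<in> K \<Longrightarrow> h \<in> H \<Longrightarrow> conj_by k h \<in> H"
  using assms by (auto simp: normal_in_def dest: subgroup.subset)

lemma normal_in_iff_normal:
  assumes "subgroup K G"
  shows "normal_in H K \<longleftrightarrow> H \<lhd> G\<lparr>carrier := K\<rparr>"
proof -
  interpret K: group "G\<lparr>carrier := K\<rparr>" by (rule subgroup_imp_group[OF assms])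
  have "subgroup H (G\<lparr>carrier := K\<rparr>) \<longleftrightarrow> subgroup H G \<and> H \<subseteq> K"
    using incl_subgroup[OF assms] subgroup_incl[OF _ assms] subgroup.subset by fastforce
  then show ?thesis
    unfolding K.normal_inv_iff normal_in_def conj_by_def using assms
    by (auto simp: m_inv_consistent)
qed

lemma normal_in_refl: "subgroup H G \<Longrightarrow> normal_in H H"
  by (auto simp: normal_in_def conj_by_def subgroup.m_closed subgroup.m_inv_closed)

lemma conj_by_mem: "\<lbrakk>subgroup H G; g \<in> H; h \<in> H\<rbrakk> \<Longrightarrow> conj_by g h \<in> H"
  by (auto simp: conj_by_def subgroup.m_closed subgroup.m_inv_closed)

lemma normal_in_triv: "subgroup H G \<Longrightarrow> normal_in {\<one>} H"
  by (auto simp: normal_in_def triv_subgroup subgroup.one_closed subgroup.mem_carrier)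

lemma normal_in_mono:
  "\<lbrakk>normal_in H K; subgroup L G; H \<subseteq> L; L \<subseteq> K\<rbrakk> \<Longrightarrow> normal_in H L"
  by (auto simp: normal_in_def)

lemma normal_in_Int:
  "\<lbrakk>normal_in H K; subgroup L G; L \<subseteq> K\<rbrakk> \<Longrightarrow> normal_in (H \<inter> L) L"
  by (auto simp: normal_in_def subgroups_Inter_pair conj_by_mem)

lemma normal_in_Int2:
  "\<lbrakk>normal_in H K; normal_in L K\<rbrakk> \<Longrightarrow> normal_in (H \<inter> L) K"
  by (auto simp: normal_in_def subgroups_Inter_pair)

lemma normal_in_conj_by:
  assumes "normal_in H K" "g \<in> carrier G"
  shows "normal_in (conj_by g ` H) (conj_by g ` K)"
proof (rule normal_inI)
  fix a b assume "a \<in> conj_by g ` K" "b \<in> conj_by g ` H"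
  then obtain k h where kh: "k \<in> K" "h \<in> H" "a = conj_by g k" "b = conj_by g h" by auto
  with normal_inD[OF assms(1)] have "k \<in> carrier G" "h \<in> carrier G" by auto
  then have "conj_by a b = conj_by g (conj_by k h)"
    using kh assms(2) by (simp add: conj_by_def group_word_simps)
  then show "conj_by a b \<in> conj_by g ` H"
    using normal_inD(6)[OF assms(1) kh(1,2)] by auto
qed (use assms normal_inD(1-3)[OF assms(1)] in \<open>auto intro: subgroup_conj_by\<close>)

lemma normal_in_conj_image:
  assumes "normal_in H K" "g \<in> K"
  shows "conj_by g ` H = H"
proof -
  note n = normal_inD[OF assms(1)]
  have g: "g \<in> carrier G" "inv g \<in> K" using n assms(2) by (auto intro: subgroup.m_inv_closed)
  have "h \<in> conj_by g ` H" if "h \<in> H" for h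
    using n(6)[OF g(2) that] that n(4) g(1) by (intro image_eqI[of _ _ "conj_by (inv g) h"]) auto
  then show ?thesis using n(6)[OF assms(2)] by auto
qed

text \<open>The commutator of \<open>n\<close> and \<open>m\<close> lies in \<open>M\<close> when
  read as \<open>conj_by n m\<close> times \<open>inv m\<close>, and in \<open>N\<close> when read
  as \<open>n\<close> times a conjugate of \<open>inv n\<close>.\<close>

lemma normal_in_commute:
  assumes N: "normal_in N H" and M: "normal_in M H" and triv: "N \<inter> M \<subseteq> {\<one>}"
    and n: "n \<in> N" and m: "m \<in> M"
  shows "n \<otimes> m = m \<otimes> n"
proof -
  note N' = normal_inD[OF N] and M' = normal_inD[OF M]
  have c: "n \<in> carrier G" "m \<in> carrier G" using n m N' M' by auto
  have "conj_by n m \<otimes> inv m \<in> M"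
    using n m N' M' by (auto intro!: subgroup.m_closed[of M] subgroup.m_inv_closed)
  moreover have "conj_by n m \<otimes> inv m = n \<otimes> conj_by m (inv n)"
    using c by (simp add: conj_by_def group_word_simps)
  moreover have "n \<otimes> conj_by m (inv n) \<in> N"
    using n m N' M' by (auto intro!: subgroup.m_closed[of N] subgroup.m_inv_closed N'(6))
  ultimately have "conj_by n m \<otimes> inv m = \<one>" using triv by auto
  then have "conj_by n m = m" using c by (metis conj_by_closed inv_closed inv_equality inv_inv)
  then show ?thesis using c by (simp add: conj_by_eq_self_iff)
qed

text \<open>Modulo \<open>N\<close> the product is just \<open>h\<close>. Stated with an explicit
  factor \<open>n'\<close>, this replaces computations in the quotient by \<open>N\<close>.\<close>

lemma normal_in_mult_pow:
  assumes N: "normal_in N H" and n: "n \<in> N" and h: "h \<in> H"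
  shows "\<exists>n'\<in>N. (n \<otimes> h) [^] (j::nat) = n' \<otimes> h [^] j"
proof (induction j)
  case 0
  then show ?case using normal_inD(1)[OF N] by (auto intro: bexI[of _ \<one>] subgroup.one_closed)
next
  case (Suc j)
  note N' = normal_inD[OF N]
  have c: "n \<in> carrier G" "h \<in> carrier G" using n h N' by auto
  obtain n' where n': "n' \<in> N" "(n \<otimes> h) [^] j = n' \<otimes> h [^] j" using Suc by auto
  have hj: "h [^] j \<in> H"
    using N'(2) h by (induction j) (auto intro: subgroup.one_closed subgroup.m_closed)
  have "(n \<otimes> h) [^] Suc j = n' \<otimes> conj_by (h [^] j) n \<otimes> h [^] Suc j"
    using n' c N' by (auto simp: conj_by_def group_word_simps subset_iff)
  then show ?case using n' N' hj n
    by (intro bexI[of _ "n' \<otimes> conj_by (h [^] j) n"]) (auto intro!: subgroup.m_closed)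
qed

definition centralizer :: "'a set \<Rightarrow> 'a set \<Rightarrow> 'a set" where
  "centralizer H S = {h \<in> H. \<forall>s\<in>S. h \<otimes> s = s \<otimes> h}"

lemma centralizer_normal_in:
  assumes H: "subgroup H G" and S: "S \<subseteq> carrier G"
    and inv: "\<And>h s. h \<in> H \<Longrightarrow> s \<in> S \<Longrightarrow> conj_by h s \<in> S"
  shows "normal_in (centralizer H S) H"
proof -
  have Hc: "h \<in> carrier G" if "h \<in> H" for h using that H by (rule subgroup.mem_carrier[rotated])
  have eq: "centralizer H S = {h \<in> H. \<forall>s\<in>S. conj_by h s = s}"
    using Hc S by (auto simp: centralizer_def conj_by_eq_self_iff subset_iff)
  show ?thesis
  proof (rule normal_inI)
    show "subgroup (centralizer H S) G"
    proof (rule subgroupI)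
      show "centralizer H S \<subseteq> carrier G" using Hc by (auto simp: eq)
      show "centralizer H S \<noteq> {}"
        using S subgroup.one_closed[OF H] by (auto simp: eq subset_iff intro!: exI[of _ \<one>])
    next
      fix a assume a: "a \<in> centralizer H S"
      have "conj_by (inv a) s = s" if "s \<in> S" for s
        using a that S Hc conj_by_inv_cancel(2)[of a s] by (auto simp: eq)
      then show "inv a \<in> centralizer H S" using a H by (auto simp: eq subgroup.m_inv_closed)
    next
      fix a b assume "a \<in> centralizer H S" "b \<in> centralizer H S"
      then show "a \<otimes> b \<in> centralizer H S"
        using S H by (auto simp: eq conj_by_comp Hc subset_iff subgroup.m_closed)
    qed
  next
    fix k h assume k: "k \<in> H" and h: "h \<in> centralizer H S"
    have kc: "k \<in> carrier G" "h \<in> carrier G" using k h Hc by (auto simp: eq)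
    have "conj_by (conj_by k h) s = s" if s: "s \<in> S" for s
    proof -
      have "conj_by (inv k) s \<in> S" using inv k s H by (simp add: subgroup.m_inv_closed)
      then have "conj_by h (conj_by (inv k) s) = conj_by (inv k) s" using h by (simp add: eq)
      moreover have "conj_by (conj_by k h) s = conj_by k (conj_by h (conj_by (inv k) s))"
        using kc s S by (auto simp: conj_by_def group_word_simps subset_iff)
      ultimately show ?thesis using kc s S by auto
    qed
    then show "conj_by k h \<in> centralizer H S"
      using k h H by (auto simp: eq conj_by_mem)
  qed (use H in \<open>auto simp: eq\<close>)
qed

section \<open>Elements of p-power order and the p-core\<close>

definition p_element :: "nat \<Rightarrow> 'a \<Rightarrow> bool" where
  "p_element p a \<longleftrightarrow> (\<exists>k::nat. a [^] (p ^ k) = \<one>)"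

lemma p_element_conj_by:
  "\<lbrakk>g \<in> carrier G; a \<in> carrier G\<rbrakk> \<Longrightarrow> p_element p (conj_by g a) \<longleftrightarrow> p_element p a"
  by (simp add: p_element_def flip: conj_by_nat_pow)

lemma p_element_one [simp]: "p_element p \<one>"
  by (simp add: p_element_def)

lemma coprime_pows_eq_one:
  assumes "a \<in> carrier G" "a [^] (m::nat) = \<one>" "a [^] (n::nat) = \<one>" "coprime m n"
  shows "a = \<one>"
  using assms by (metis coprime_common_divisor_nat nat_dvd_1_iff_1 ord_eq_1 pow_eq_id)

lemma p_element_distinct_primes:
  assumes "a \<in> carrier G" "p_element p a" "p_element q a" "prime p" "prime q" "p \<noteq> q"
  shows "a = \<one>"
proof -
  obtain j k where "a [^] (p ^ j) = \<one>" "a [^] (q ^ k) = \<one>"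
    using assms(2,3) by (auto simp: p_element_def)
  moreover have "coprime (p ^ j) (q ^ k)" using assms by (simp add: primes_coprime)
  ultimately show ?thesis using coprime_pows_eq_one assms(1) by blast
qed

text \<open>This is O_p(H). Being a p-group is expressed element by element, so no orders are
  counted; that the union is a subgroup rests on \<open>p_core_mult_closed\<close>.\<close>

definition p_core :: "nat \<Rightarrow> 'a set \<Rightarrow> 'a set" where
  "p_core p H = \<Union>{N. normal_in N H \<and> (\<forall>n\<in>N. p_element p n)}"

lemma p_core_p_element: "a \<in> p_core p H \<Longrightarrow> p_element p a"
  by (auto simp: p_core_def)

lemma p_core_upper: "\<lbrakk>normal_in N H; \<And>n. n \<in> N \<Longrightarrow> p_element p n\<rbrakk> \<Longrightarrow> N \<subseteq> p_core p H"
  by (auto simp: p_core_def)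

text \<open>If \<open>a\<close> and \<open>b\<close> come from normal p-subgroups \<open>N\<close>
  and \<open>M\<close>, then the product set \<open>P\<close> of \<open>N\<close> and
  \<open>M\<close> is again a normal subgroup of \<open>H\<close> and consists of
  p-elements.\<close>

lemma p_core_mult_closed:
  assumes "a \<in> p_core p H" "b \<in> p_core p H"
  shows "a \<otimes> b \<in> p_core p H"
proof -
  obtain N M where N: "normal_in N H" "\<forall>n\<in>N. p_element p n" "a \<in> N"
    and M: "normal_in M H" "\<forall>n\<in>M. p_element p n" "b \<in> M"
    using assms by (auto simp: p_core_def)
  note N' = normal_inD[OF N(1)] and M' = normal_inD[OF M(1)]
  have c: "n \<in> carrier G" if "n \<in> H" for n using that N' by auto
  have nc: "n \<in> carrier G" "n \<in> H" if "n \<in> N" for n using that N' by auto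
  have mc: "n \<in> carrier G" "n \<in> H" if "n \<in> M" for n using that M' by auto
  define P where "P = {n \<otimes> m | n m. n \<in> N \<and> m \<in> M}"
  have "subgroup P G"
  proof (rule subgroupI)
    show "P \<subseteq> carrier G" using nc mc by (auto simp: P_def)
    show "P \<noteq> {}" using N(3) M(3) by (auto simp: P_def)
  next
    fix x assume "x \<in> P"
    then obtain n m where x: "x = n \<otimes> m" "n \<in> N" "m \<in> M" by (auto simp: P_def)
    then have "inv x = conj_by (inv m) (inv n) \<otimes> inv m"
      using nc mc by (simp add: conj_by_def group_word_simps)
    moreover have "conj_by (inv m) (inv n) \<in> N" "inv m \<in> M"
      using x N' M' mc by (auto intro!: N'(6) subgroup.m_inv_closed)
    ultimately show "inv x \<in> P" by (auto simp: P_def)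
  next
    fix x y assume "x \<in> P" "y \<in> P"
    then obtain n m n' m' where x: "x = n \<otimes> m" "n \<in> N" "m \<in> M" and y: "y = n' \<otimes> m'" "n' \<in> N" "m' \<in> M"
      by (auto simp: P_def)
    then have "x \<otimes> y = (n \<otimes> conj_by m n') \<otimes> (m \<otimes> m')"
      using nc mc by (simp add: conj_by_def group_word_simps)
    moreover have "n \<otimes> conj_by m n' \<in> N" "m \<otimes> m' \<in> M"
      using x y N' M' mc by (auto intro: subgroup.m_closed)
    ultimately show "x \<otimes> y \<in> P" by (auto simp: P_def)
  qed
  then have "normal_in P H"
  proof (rule normal_inI)
    show "P \<subseteq> H" using nc mc N'(2) by (auto simp: P_def intro: subgroup.m_closed)
    fix k h assume k: "k \<in> H" and "h \<in> P"
    then obtain n m where h: "h = n \<otimes> m" "n \<in> N" "m \<in> M" by (auto simp: P_def)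
    then have "conj_by k h = conj_by k n \<otimes> conj_by k m"
      using k c nc mc by (auto simp: conj_by_mult)
    moreover have "conj_by k n \<in> N" "conj_by k m \<in> M" using N'(6) M'(6) k h by auto
    ultimately show "conj_by k h \<in> P" by (auto simp: P_def)
  qed (use N' in simp)
  moreover have "p_element p x" if xP: "x \<in> P" for x
  proof -
    obtain n m where x: "x = n \<otimes> m" "n \<in> N" "m \<in> M" using xP by (auto simp: P_def)
    \<comment> \<open>Raising \<open>x\<close> to the power \<open>p ^ j\<close> kills its
      \<open>M\<close>-part modulo \<open>N\<close> and leaves an element of \<open>N\<close>, which
      a further power of \<open>p\<close> kills.\<close>
    obtain j where j: "m [^] (p ^ j) = \<one>" using x M(2) by (auto simp: p_element_def)
    obtain n' where n': "n' \<in> N" "x [^] (p ^ j) = n' \<otimes> m [^] (p ^ j)"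
      using normal_in_mult_pow[OF N(1) x(2) mc(2)[OF x(3)], of "p ^ j"] x(1) by blast
    obtain i where i: "n' [^] (p ^ i) = \<one>" using n' N(2) by (auto simp: p_element_def)
    have "x [^] (p ^ (j + i)) = \<one>"
      using n' j i nc mc x by (simp add: power_add flip: nat_pow_pow)
    then show ?thesis by (auto simp: p_element_def)
  qed
  ultimately have "P \<subseteq> p_core p H" by (rule p_core_upper)
  then show ?thesis using N(3) M(3) by (auto simp: P_def)
qed

lemma p_core_normal_in:
  assumes "subgroup H G"
  shows "normal_in (p_core p H) H"
proof -
  have "subgroup (p_core p H) G"
  proof (rule subgroupI)
    show "p_core p H \<subseteq> carrier G" by (auto simp: p_core_def dest: normal_inD)
    have "\<one> \<in> p_core p H"
      using p_core_upper[OF normal_in_triv[OF assms], of p] by auto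
    then show "p_core p H \<noteq> {}" by auto
  next
    fix a assume "a \<in> p_core p H"
    then obtain N where "normal_in N H" "\<forall>n\<in>N. p_element p n" "a \<in> N"
      by (auto simp: p_core_def)
    moreover from this have "inv a \<in> N" by (auto dest: normal_inD(1) subgroup.m_inv_closed)
    ultimately show "inv a \<in> p_core p H" by (auto simp: p_core_def)
  qed (rule p_core_mult_closed)
  then show ?thesis
    using assms by (auto simp: normal_in_def p_core_def)
qed

lemma p_core_conj_by:
  assumes "g \<in> carrier G" "subgroup H G"
  shows "conj_by g ` p_core p H \<subseteq> p_core p (conj_by g ` H)"
  by (rule p_core_upper[OF normal_in_conj_by[OF p_core_normal_in]])
    (use assms normal_inD(4)[OF p_core_normal_in[OF assms(2)]] in
      \<open>auto simp: p_element_conj_by subset_iff p_core_p_element\<close>)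

text \<open>Conjugation by an element of \<open>K\<close> is an automorphism of \<open>H\<close>, so
  it preserves the p-core of \<open>H\<close>.\<close>

lemma p_core_char:
  assumes "normal_in H K"
  shows "normal_in (p_core p H) K"
proof (rule normal_inI)
  note n = normal_inD[OF assms]
  fix k h assume k: "k \<in> K" and h: "h \<in> p_core p H"
  have "k \<in> carrier G" using k n by blast
  then have "conj_by k ` p_core p H \<subseteq> p_core p H"
    using p_core_conj_by[of k H p] normal_in_conj_image[OF assms k] n by auto
  then show "conj_by k h \<in> p_core p H" using h by auto
qed (use normal_inD[OF assms] normal_inD[OF p_core_normal_in[OF normal_inD(1)[OF assms]]] in blast)+

lemma p_core_mono: "normal_in H K \<Longrightarrow> p_core p H \<subseteq> p_core p K"
  by (rule p_core_upper[OF p_core_char]) (auto simp: p_core_p_element)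

lemma p_core_Int:
  assumes "subgroup K G" "subgroup H G" "H \<subseteq> K"
  shows "p_core p K \<inter> H \<subseteq> p_core p H"
  by (rule p_core_upper[OF normal_in_Int[OF p_core_normal_in]])
    (use assms in \<open>auto simp: p_core_p_element\<close>)

lemma p_core_disjoint:
  assumes "subgroup H G" "prime p" "prime q" "p \<noteq> q"
  shows "p_core p H \<inter> p_core q K \<subseteq> {\<one>}"
proof
  fix a assume a: "a \<in> p_core p H \<inter> p_core q K"
  then have "a \<in> carrier G" using normal_inD(4)[OF p_core_normal_in[OF assms(1)]] by blast
  then show "a \<in> {\<one>}"
    using a p_element_distinct_primes[of a p q] assms by (auto dest: p_core_p_element)
qed

end

section \<open>Subnormal quasisimple subgroups\<close>

context group
begin

section \<open>Subnormal subgroups of a subgroup of the ambient group\<close>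

lemma subnormal_in_induct [consumes 2, case_names whole step]:
  assumes "subgroup B G" "subnormal (G\<lparr>carrier := B\<rparr>) L"
    and "P B"
    and "\<And>K H. \<lbrakk>subnormal (G\<lparr>carrier := B\<rparr>) K; P K; normal_in H K; K \<subseteq> B\<rbrakk> \<Longrightarrow> P H"
  shows "P L"
proof -
  have "subgroup L G \<and> L \<subseteq> B \<and> P L"
    using assms(2)
  proof induction
    case whole
    then show ?case using assms by simp
  next
    case (step K H)
    then have "normal_in H K" by (simp add: normal_in_iff_normal)
    then show ?case using step assms(4)[of K H] by (auto dest: normal_inD)
  qed
  then show ?thesis by simp
qed

lemma subnormal_in_whole: "subnormal (G\<lparr>carrier := B\<rparr>) B"
  using subnormal.whole[of "G\<lparr>carrier := B\<rparr>"] by simp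

lemma subnormal_in_step:
  assumes "subnormal (G\<lparr>carrier := B\<rparr>) K" "normal_in H K"
  shows "subnormal (G\<lparr>carrier := B\<rparr>) H"
  by (rule subnormal.step[OF assms(1)])
    (use assms(2) normal_in_iff_normal[of K H] normal_inD(2)[OF assms(2)] in simp)

lemma subnormal_in_subgroup:
  assumes "subgroup B G" "subnormal (G\<lparr>carrier := B\<rparr>) L"
  shows "subgroup L G" "L \<subseteq> B"
proof -
  have "subgroup L G \<and> L \<subseteq> B"
    using assms by (induction rule: subnormal_in_induct) (auto simp: assms(1) dest: normal_inD)
  then show "subgroup L G" "L \<subseteq> B" by auto
qed

lemma subnormal_in_normal:
  assumes "normal_in Q B" "subnormal (G\<lparr>carrier := Q\<rparr>) L"
  shows "subnormal (G\<lparr>carrier := B\<rparr>) L"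
  using normal_inD(1)[OF assms(1)] assms(2)
proof (induction rule: subnormal_in_induct)
  case whole
  show ?case by (rule subnormal_in_step[OF subnormal_in_whole assms(1)])
next
  case (step K H)
  then show ?case by (blast intro: subnormal_in_step)
qed

text \<open>Intersecting every member of a subnormal chain from \<open>B\<close> to \<open>L\<close>
  with \<open>Q\<close> gives a subnormal chain from \<open>Q\<close>.\<close>

lemma subnormal_in_Int:
  assumes "subgroup B G" "subnormal (G\<lparr>carrier := B\<rparr>) L" and Q: "subgroup Q G" "Q \<subseteq> B"
  shows "subnormal (G\<lparr>carrier := Q\<rparr>) (L \<inter> Q)"
  using assms(1,2)
proof (induction rule: subnormal_in_induct)
  case whole
  then show ?case using Q by (simp add: Int_absorb1 subnormal_in_whole)
next
  case (step K H)
  have HK: "normal_in H K" by fact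
  have "normal_in (H \<inter> (K \<inter> Q)) (K \<inter> Q)"
    using normal_inD(2)[OF HK] Q by (intro normal_in_Int[OF HK] subgroups_Inter_pair) auto
  moreover have "H \<inter> (K \<inter> Q) = H \<inter> Q" using normal_inD(3)[OF HK] by auto
  ultimately show ?case using subnormal_in_step[OF step.IH] by simp
qed

lemma subnormal_in_conj_by:
  assumes g: "g \<in> carrier G" and "subgroup B G" "subnormal (G\<lparr>carrier := B\<rparr>) L"
  shows "subnormal (G\<lparr>carrier := conj_by g ` B\<rparr>) (conj_by g ` L)"
  using assms(2,3)
proof (induction rule: subnormal_in_induct)
  case whole
  then show ?case by (rule subnormal_in_whole)
next
  case (step K H)
  then show ?case using g by (blast intro: subnormal_in_step normal_in_conj_by)
qed

text \<open>\<open>p_core_mono\<close> applies at each link of the subnormal chain.\<close>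

lemma p_core_subnormal:
  assumes "subgroup B G" "subnormal (G\<lparr>carrier := B\<rparr>) L"
  shows "p_core p L \<subseteq> p_core p B"
  using assms
proof (induction rule: subnormal_in_induct)
  case (step K H)
  then show ?case using p_core_mono[of H K p] by blast
qed simp

text \<open>Quasisimplicity phrased without the central quotient.\<close>

definition quasisimple_in :: "'a set \<Rightarrow> bool" where
  "quasisimple_in L \<longleftrightarrow> subgroup L G \<and> L \<noteq> {\<one>} \<and> derived G L = L \<and>
     (\<forall>N. normal_in N L \<longrightarrow> N = L \<or> N \<subseteq> centralizer L L)"

lemma quasisimple_in_conj_by:
  assumes g: "g \<in> carrier G" and L: "quasisimple_in L"
  shows "quasisimple_in (conj_by g ` L)"
proof -
  have L': "subgroup L G" "L \<noteq> {\<one>}" "derived G L = L"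
    "\<And>N. normal_in N L \<Longrightarrow> N = L \<or> N \<subseteq> centralizer L L"
    using L by (auto simp only: quasisimple_in_def)
  have sub: "L \<subseteq> carrier G" "\<one> \<in> L" using L'(1) by (auto dest: subgroup.subset subgroup.one_closed)
  have "conj_by g ` L \<noteq> {\<one>}"
  proof
    assume "conj_by g ` L = {\<one>}"
    then have "conj_by g l = \<one>" if "l \<in> L" for l using that by blast
    then have "\<forall>l\<in>L. l = \<one>" using conj_by_eq_one_iff[OF g] sub(1) by blast
    then show False using L'(2) sub(2) by blast
  qed
  moreover have "derived G (conj_by g ` L) = conj_by g ` L"
    using group_hom.derived_img[OF conj_by_hom[OF g] sub(1)] L'(3) by simp
  moreover have "N = conj_by g ` L \<or> N \<subseteq> centralizer (conj_by g ` L) (conj_by g ` L)"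
    if N: "normal_in N (conj_by g ` L)" for N
  proof -
    have Nc: "N \<subseteq> carrier G" using normal_inD[OF N] by auto
    have "normal_in (conj_by (inv g) ` N) L"
      using normal_in_conj_by[OF N, of "inv g"] g sub by (simp add: conj_by_image_inv_cancel)
    then consider "conj_by (inv g) ` N = L" | "conj_by (inv g) ` N \<subseteq> centralizer L L"
      using L'(4) by blast
    then show ?thesis
    proof cases
      case 1
      then show ?thesis using conj_by_image_inv_cancel[OF g Nc] by simp
    next
      case 2
      have "N \<subseteq> conj_by g ` centralizer L L"
        using image_mono[OF 2, of "conj_by g"] conj_by_image_inv_cancel[OF g Nc] by simp
      also have "\<dots> \<subseteq> centralizer (conj_by g ` L) (conj_by g ` L)"
        using g sub by (auto simp: centralizer_def subset_iff simp flip: conj_by_mult)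
      finally show ?thesis by simp
    qed
  qed
  ultimately show ?thesis using subgroup_conj_by[OF g L'(1)] by (simp add: quasisimple_in_def)
qed

section \<open>Quasisimple groups and their normal subgroups\<close>

lemma derived_subsetI:
  assumes "subgroup H G" "\<And>a b. \<lbrakk>a \<in> L; b \<in> L\<rbrakk> \<Longrightarrow> a \<otimes> b \<otimes> inv a \<otimes> inv b \<in> H"
  shows "derived G L \<subseteq> H"
  unfolding derived_def by (rule generate_subgroup_incl[OF _ assms(1)]) (use assms(2) in auto)

lemma group_center_eq: "group_center G = centralizer (carrier G) (carrier G)"
  unfolding group_center_def centralizer_def ..

lemma group_center_normal: "group_center G \<lhd> G"
  using centralizer_normal_in[OF subgroup_self, of "carrier G"] normal_in_iff_normal[OF subgroup_self]
  by (simp add: group_center_eq)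

lemma mult_swap_middle:
  assumes "x \<otimes> y = y \<otimes> x" "x \<in> carrier G" "y \<in> carrier G" "v \<in> carrier G" "w \<in> carrier G"
  shows "(v \<otimes> x) \<otimes> (y \<otimes> w) = (v \<otimes> y) \<otimes> (x \<otimes> w)"
proof -
  have "(v \<otimes> x) \<otimes> (y \<otimes> w) = v \<otimes> (x \<otimes> y) \<otimes> w" using assms(2-5) by (simp add: m_assoc)
  also have "\<dots> = (v \<otimes> y) \<otimes> (x \<otimes> w)" unfolding assms(1) using assms(2-5) by (simp add: m_assoc)
  finally show ?thesis .
qed

text \<open>The image of \<open>N\<close> in the simple central quotient is everything or trivial.
  If trivial, \<open>N\<close> is central. If everything, each element is a central element times an
  element of \<open>N\<close>, so all commutators lie in \<open>N\<close>, and perfectness gives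
  equality.\<close>

lemma quasisimple_normal_cases:
  assumes q: "quasisimple_group G" and N: "N \<lhd> G"
  shows "N = carrier G \<or> N \<subseteq> group_center G"
proof -
  define Z where "Z = group_center G"
  interpret Z: normal Z G unfolding Z_def by (rule group_center_normal)
  interpret N: normal N G by (rule N)
  interpret S: simple_group "G Mod Z" using q by (simp add: quasisimple_group_def Z_def)
  have hom: "group_hom G (G Mod Z) (\<lambda>a. Z #> a)"
    by (rule group_hom.intro) (simp_all add: Z.factorgroup_is_group group_hom_axioms_def Z.r_coset_hom_Mod)
  have "(\<lambda>a. Z #> a) ` N \<lhd> G Mod Z"
    by (rule N.surj_hom_normal_subgroup[OF hom]) (simp add: carrier_FactGroup)
  from S.no_real_normal_subgroup[OF this]
  consider "(\<lambda>a. Z #> a) ` N = carrier (G Mod Z)" | "(\<lambda>a. Z #> a) ` N = {Z}"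
    by auto
  then show ?thesis
  proof cases
    case 1
    have ex: "\<exists>z n. z \<in> Z \<and> n \<in> N \<and> a = z \<otimes> n" if a: "a \<in> carrier G" for a
    proof -
      have "Z #> a \<in> (\<lambda>a. Z #> a) ` N" using a by (simp add: 1 carrier_FactGroup)
      then obtain n where n: "n \<in> N" "Z #> a = Z #> n" by auto
      then have "a \<in> Z #> n" using rcos_self[OF a Z.subgroup_axioms] by simp
      then show ?thesis using n by (auto simp: r_coset_def)
    qed
    have "derived G (carrier G) \<subseteq> N"
    proof (rule derived_subsetI[OF N.subgroup_axioms])
      fix a b assume ab: "a \<in> carrier G" "b \<in> carrier G"
      then obtain y m z n where y: "y \<in> Z" "m \<in> N" "a = y \<otimes> m" and z: "z \<in> Z" "n \<in> N" "b = z \<otimes> n"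
        using ex by metis
      have c: "y \<in> carrier G" "m \<in> carrier G" "z \<in> carrier G" "n \<in> carrier G"
        using y z by auto
      have cen: "\<And>x z. \<lbrakk>z \<in> Z; x \<in> carrier G\<rbrakk> \<Longrightarrow> z \<otimes> x = x \<otimes> z"
        by (auto simp only: Z_def group_center_def)
      have "a \<otimes> b = (y \<otimes> z) \<otimes> (m \<otimes> n)" "b \<otimes> a = (y \<otimes> z) \<otimes> (n \<otimes> m)"
        unfolding y(3) z(3)
        by (simp_all only: mult_swap_middle[OF cen[OF z(1) c(2), symmetric] c(2,3,1,4)]
          mult_swap_middle[OF cen[OF y(1) c(4), symmetric] c(4,1,3,2)] cen[OF z(1) c(1)])
      moreover have "a \<otimes> b \<otimes> inv a \<otimes> inv b = (a \<otimes> b) \<otimes> inv (b \<otimes> a)"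
        using ab by (simp add: group_word_simps)
      ultimately have "a \<otimes> b \<otimes> inv a \<otimes> inv b
          = ((y \<otimes> z) \<otimes> (m \<otimes> n)) \<otimes> inv ((y \<otimes> z) \<otimes> (n \<otimes> m))" by (simp only:)
      also have "\<dots> = (y \<otimes> z) \<otimes> ((m \<otimes> n) \<otimes> inv (n \<otimes> m)) \<otimes> inv (y \<otimes> z)"
        using c by (simp add: group_word_simps)
      finally have "a \<otimes> b \<otimes> inv a \<otimes> inv b
          = (y \<otimes> z) \<otimes> ((m \<otimes> n) \<otimes> inv (n \<otimes> m)) \<otimes> inv (y \<otimes> z)" .
      moreover have "m \<otimes> n \<otimes> inv (n \<otimes> m) \<in> N" using y z by simp
      ultimately show "a \<otimes> b \<otimes> inv a \<otimes> inv b \<in> N"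
        using N.inv_op_closed2[of "y \<otimes> z"] c by simp
    qed
    then show ?thesis using q N.subset by (auto simp: quasisimple_group_def)
  next
    case 2
    have "n \<in> Z" if "n \<in> N" for n
      using 2 that rcos_self[OF _ Z.subgroup_axioms, of n] by auto
    then show ?thesis by (auto simp: Z_def)
  qed
qed

lemma quasisimple_group_imp_in:
  assumes L: "subgroup L G" and q: "quasisimple_group (G\<lparr>carrier := L\<rparr>)"
  shows "quasisimple_in L"
proof -
  interpret L: group "G\<lparr>carrier := L\<rparr>" by (rule subgroup_imp_group[OF L])
  have "L \<noteq> {\<one>}"
  proof
    assume "L = {\<one>}"
    then have "card (carrier (G\<lparr>carrier := L\<rparr> Mod group_center (G\<lparr>carrier := L\<rparr>))) \<le> 1"
      by (simp add: carrier_FactGroup)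
    moreover have "simple_group (G\<lparr>carrier := L\<rparr> Mod group_center (G\<lparr>carrier := L\<rparr>))"
      using q by (simp add: quasisimple_group_def)
    ultimately show False using simple_group.order_gt_one by (fastforce simp: order_def)
  qed
  moreover have "derived G L = L"
    using q derived_consistent[OF subset_refl L] by (simp add: quasisimple_group_def)
  moreover have "N = L \<or> N \<subseteq> centralizer L L" if "normal_in N L" for N
    using L.quasisimple_normal_cases[OF q, of N] that L
    by (auto simp: normal_in_iff_normal group_center_def centralizer_def)
  ultimately show ?thesis using L by (simp add: quasisimple_in_def)
qed

text \<open>Meant for \<open>conj_by q a = u \<otimes> a\<close> and
  \<open>conj_by q b = v \<otimes> b\<close>: it then says that conjugation by \<open>q\<close>
  fixes the commutator of \<open>a\<close> and \<open>b\<close>.\<close>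

lemma commutator_of_central_multiples:
  assumes c: "a \<in> carrier G" "b \<in> carrier G" "u \<in> carrier G" "v \<in> carrier G"
    and comm: "conj_by u a = a" "conj_by u b = b" "conj_by v a = a" "conj_by v b = b" "conj_by u v = v"
  shows "(u \<otimes> a) \<otimes> (v \<otimes> b) \<otimes> inv (u \<otimes> a) \<otimes> inv (v \<otimes> b) = a \<otimes> b \<otimes> inv a \<otimes> inv b"
proof -
  have e: "v \<otimes> a = a \<otimes> v" "u \<otimes> b = b \<otimes> u" "u \<otimes> v = v \<otimes> u"
    using comm c by (simp_all add: conj_by_eq_self_iff)
  have 1: "(u \<otimes> a) \<otimes> (v \<otimes> b) = (u \<otimes> v) \<otimes> (a \<otimes> b)" "(v \<otimes> b) \<otimes> (u \<otimes> a) = (u \<otimes> v) \<otimes> (b \<otimes> a)"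
    using mult_swap_middle[OF e(1)[symmetric], of u b] mult_swap_middle[OF e(2)[symmetric], of v a] e(3) c
    by auto
  have "(u \<otimes> a) \<otimes> (v \<otimes> b) \<otimes> inv (u \<otimes> a) \<otimes> inv (v \<otimes> b)
      = ((u \<otimes> a) \<otimes> (v \<otimes> b)) \<otimes> inv ((v \<otimes> b) \<otimes> (u \<otimes> a))"
    using c by (simp add: group_word_simps)
  also have "\<dots> = conj_by (u \<otimes> v) (a \<otimes> b \<otimes> inv a \<otimes> inv b)"
    unfolding 1 using c by (simp add: conj_by_def group_word_simps)
  also have "\<dots> = a \<otimes> b \<otimes> inv a \<otimes> inv b"
    using c comm by (simp add: conj_by_mult conj_by_inv conj_by_comp)
  finally show ?thesis .
qed

text \<open>An instance of the three subgroups lemma: \<open>[L, N] \<le> M \<inter> N\<close> commutes with the perfect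
  group \<open>L\<close>.\<close>

lemma perfect_centralizes_normal:
  assumes M: "normal_in M K" and N: "normal_in N K"
    and L: "subgroup L G" "L \<subseteq> M" "derived G L = L"
    and comm: "\<And>l n. \<lbrakk>l \<in> L; n \<in> N \<inter> M\<rbrakk> \<Longrightarrow> l \<otimes> n = n \<otimes> l"
    and l: "l \<in> L" and q: "q \<in> N"
  shows "l \<otimes> q = q \<otimes> l"
proof -
  note M' = normal_inD[OF M] and N' = normal_inD[OF N]
  have Lc: "a \<in> carrier G" "a \<in> M" "a \<in> K" if "a \<in> L" for a using that L M' by auto
  have qc: "q \<in> carrier G" "q \<in> K" using q N' by auto
  \<comment> \<open>\<open>C\<close> is the centraliser of \<open>q\<close> in \<open>L\<close>. As
    \<open>L\<close> is perfect, it is enough that \<open>C\<close> contains all commutators of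
    elements of \<open>L\<close>.\<close>
  define C where "C = {a \<in> L. conj_by q a = a}"
  \<comment> \<open>The commutator of \<open>q\<close> and \<open>a\<close> lies in \<open>N\<close>
    and in \<open>M\<close> because both are normal in \<open>K\<close>; by \<open>comm\<close> it
    therefore commutes with all of \<open>L\<close>.\<close>
  have D: "conj_by q a \<otimes> inv a \<in> N \<inter> M" if a: "a \<in> L" for a
  proof -
    have "conj_by q a \<otimes> inv a = q \<otimes> conj_by a (inv q)"
      using qc Lc[OF a] by (simp add: conj_by_def group_word_simps)
    moreover have "q \<otimes> conj_by a (inv q) \<in> N"
      using q N' Lc[OF a] by (auto intro!: subgroup.m_closed subgroup.m_inv_closed N'(6))
    moreover have "conj_by q a \<otimes> inv a \<in> M"
      using qc M' Lc[OF a] by (auto intro!: subgroup.m_closed[of M] subgroup.m_inv_closed)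
    ultimately show ?thesis by simp
  qed
  have fixd: "conj_by n a = a" if "n \<in> N \<inter> M" "a \<in> L" for n a
    using comm[OF that(2,1)] that Lc N' by (subst conj_by_eq_self_iff) auto
  have NM: "conj_by (inv q) n \<in> N \<inter> M" if "n \<in> N \<inter> M" for n
    using that N'(6)[of "inv q" n] M'(6)[of "inv q" n] subgroup.m_inv_closed[OF N'(2) qc(2)] by auto
  have "subgroup C G"
  proof (rule subgroupI)
    show "C \<noteq> {}" using subgroup.one_closed[OF L(1)] qc by (auto simp: C_def intro!: exI[of _ \<one>])
  qed (use L Lc qc in \<open>auto simp: C_def conj_by_inv conj_by_mult subgroup.m_closed subgroup.m_inv_closed\<close>)
  then have "derived G L \<subseteq> C"
  proof (rule derived_subsetI)
    fix a b assume ab: "a \<in> L" "b \<in> L"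
    define u v where "u = conj_by q a \<otimes> inv a" and "v = conj_by q b \<otimes> inv b"
    have u: "u \<in> N \<inter> M" "u \<in> carrier G" and v: "v \<in> N \<inter> M" "v \<in> carrier G"
      using D ab qc Lc by (auto simp: u_def v_def)
    have qa: "conj_by q a = u \<otimes> a" "conj_by q b = v \<otimes> b"
      using ab qc Lc by (simp_all add: u_def v_def group_word_simps)
    have va: "conj_by v a = a" using fixd v ab by simp
    \<comment> \<open>It remains to see that \<open>u\<close> and \<open>v\<close> commute. The
      conjugate of \<open>v\<close> by \<open>inv q\<close> is again in \<open>N \<inter> M\<close>
      and so fixes \<open>a\<close>; hence \<open>v\<close> fixes \<open>conj_by q a\<close> as well
      as \<open>a\<close>, and with them their quotient \<open>u\<close>.\<close>
    have "conj_by v (conj_by q a) = conj_by q (conj_by (conj_by (inv q) v) a)"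
      using qc v Lc ab by (simp add: conj_by_def group_word_simps)
    also have "\<dots> = conj_by q a" using fixd[OF NM[OF v(1)] ab(1)] by simp
    finally have "conj_by v u = u"
      unfolding u_def using qc v Lc ab va by (simp add: conj_by_mult conj_by_inv)
    then have uv: "conj_by u v = v" using u v by (simp add: conj_by_eq_self_iff)
    have "conj_by q (a \<otimes> b \<otimes> inv a \<otimes> inv b) = a \<otimes> b \<otimes> inv a \<otimes> inv b"
      using commutator_of_central_multiples[OF _ _ u(2) v(2) _ _ _ _ uv, of a b] ab Lc qc fixd u v
      by (simp add: conj_by_mult conj_by_inv qa)
    moreover have "a \<otimes> b \<otimes> inv a \<otimes> inv b \<in> L"
      using ab L by (auto intro: subgroup.m_closed subgroup.m_inv_closed)
    ultimately show "a \<otimes> b \<otimes> inv a \<otimes> inv b \<in> C" by (simp add: C_def)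
  qed
  then have "conj_by q l = l" using L(3) l by (auto simp: C_def)
  then show ?thesis using qc Lc[OF l] by (simp add: conj_by_eq_self_iff)
qed

text \<open>For \<open>H = L\<close> the alternative is quasisimplicity. It passes from
  \<open>H\<close> to a group \<open>K\<close> in which \<open>H\<close> is normal: either
  \<open>N \<inter> H\<close> contains \<open>L\<close>, or \<open>L\<close> centralises
  \<open>N \<inter> H\<close> and then, being perfect, all of \<open>N\<close> by
  \<open>perfect_centralizes_normal\<close>.\<close>

lemma quasisimple_subnormal_cases:
  assumes B: "subgroup B G" and L: "subnormal (G\<lparr>carrier := B\<rparr>) L" "quasisimple_in L"
    and N: "normal_in N B"
  shows "L \<subseteq> N \<or> (\<forall>l\<in>L. \<forall>n\<in>N. l \<otimes> n = n \<otimes> l)"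
proof -
  define P where "P H \<longleftrightarrow> (\<forall>N. normal_in N H \<longrightarrow> L \<subseteq> N \<or> (\<forall>l\<in>L. \<forall>n\<in>N. l \<otimes> n = n \<otimes> l))" for H
  have L': "subgroup L G" "L \<noteq> {\<one>}" "derived G L = L"
    "\<And>N. normal_in N L \<Longrightarrow> N = L \<or> N \<subseteq> centralizer L L"
    using L(2) by (auto simp only: quasisimple_in_def)
  have up: "P K" if P: "P H" and HK: "normal_in H K" and LH: "L \<subseteq> H" for H K
    unfolding P_def
  proof (intro allI impI)
    fix N assume N: "normal_in N K"
    have "normal_in (N \<inter> H) H"
      using normal_inD[OF HK] by (intro normal_in_Int[OF N]) auto
    then consider "L \<subseteq> N \<inter> H" | "\<forall>l\<in>L. \<forall>n\<in>N \<inter> H. l \<otimes> n = n \<otimes> l"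
      using P unfolding P_def by meson
    then show "L \<subseteq> N \<or> (\<forall>l\<in>L. \<forall>n\<in>N. l \<otimes> n = n \<otimes> l)"
    proof cases
      case 2
      then show ?thesis
        using perfect_centralizes_normal[OF HK N L'(1) LH L'(3)] by blast
    qed auto
  qed
  \<comment> \<open>The induction descends from \<open>B\<close>, whereas \<open>P\<close> is to be
    lifted towards \<open>B\<close>; so the claim carried along the chain is an implication, used at
    the end for \<open>H = L\<close>.\<close>
  have "L \<subseteq> H \<longrightarrow> P H \<longrightarrow> P B" if "subnormal (G\<lparr>carrier := B\<rparr>) H" for H
    using B that
  proof (induction rule: subnormal_in_induct)
    case (step K H)
    then show ?case using up[of H K] by (auto dest: normal_inD(3))
  qed simp
  moreover have "P L"
    unfolding P_def centralizer_def using L'(4) by (fastforce simp: centralizer_def)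
  ultimately show ?thesis using L N by (auto simp: P_def)
qed

end

section \<open>Nilpotent normal subgroups and the generalised Fitting subgroup\<close>

lemma prime_power_if_unique_prime_divisor:
  fixes n p :: nat
  assumes "n > 0" "prime p" "\<And>q. prime q \<Longrightarrow> q dvd n \<Longrightarrow> q = p"
  shows "\<exists>k. n = p ^ k"
proof -
  obtain m where m: "n = p ^ multiplicity p n * m" "\<not> p dvd m"
    using multiplicity_decompose'[of n p] assms(1,2) not_prime_unit by blast
  have "m = 1"
  proof (rule ccontr)
    assume "m \<noteq> 1"
    then obtain q where "prime q" "q dvd m" using prime_factor_nat by blast
    moreover from this have "q dvd n" by (subst m(1)) simp
    ultimately show False using assms(3)[of q] m(2) by blast
  qed
  then show ?thesis using m by auto
qed

context group
begin

section \<open>Elements of prime order and p-groups\<close>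

lemma subgroup_nat_pow_closed: "\<lbrakk>subgroup H G; h \<in> H\<rbrakk> \<Longrightarrow> h [^] (n::nat) \<in> H"
  by (induction n) (auto intro: subgroup.one_closed subgroup.m_closed)

lemma commute_if_commutator_eq_one:
  assumes "a \<in> carrier G" "b \<in> carrier G" "a \<otimes> b \<otimes> inv a \<otimes> inv b = \<one>"
  shows "a \<otimes> b = b \<otimes> a"
proof -
  have "a \<otimes> b = (a \<otimes> b \<otimes> inv a \<otimes> inv b) \<otimes> (b \<otimes> a)"
    using assms(1,2) by (simp add: group_word_simps)
  then show ?thesis unfolding assms(3) using assms(1,2) by simp
qed

lemma exists_power_of_prime_order:
  assumes "finite (carrier G)" "s \<in> carrier G" "prime q" "q dvd ord s"
  shows "s [^] (ord s div q) \<noteq> \<one>" "(s [^] (ord s div q)) [^] q = \<one>"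
proof -
  have "ord s > 0" using ord_ge_1[OF assms(1,2)] by simp
  then have "0 < ord s div q" "ord s div q < ord s"
    using assms(3,4) prime_gt_1_nat[of q] dvd_imp_le[of q "ord s"]
    by (auto simp: div_greater_zero_iff)
  then have "\<not> ord s dvd ord s div q" by (auto dest: dvd_imp_le)
  then show "s [^] (ord s div q) \<noteq> \<one>" using assms pow_eq_id by blast
  show "(s [^] (ord s div q)) [^] q = \<one>" using assms by (simp add: nat_pow_pow)
qed

text \<open>If a prime \<open>q\<close> other than \<open>p\<close> divided the order of
  \<open>h\<close>, a power of \<open>h\<close> would have order \<open>q\<close>.\<close>

lemma p_element_if_no_other_prime_order:
  assumes "finite (carrier G)" "subgroup H G" "prime p" "h \<in> H"
    and "\<And>q u. \<lbrakk>prime q; q \<noteq> p; u \<in> H; u [^] q = \<one>\<rbrakk> \<Longrightarrow> u = \<one>"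
  shows "p_element p h"
proof -
  have h: "h \<in> carrier G" using assms(2,4) by (rule subgroup.mem_carrier)
  have pow: "h [^] (n::nat) \<in> H" for n
    using assms(2,4) by (rule subgroup_nat_pow_closed)
  have "q = p" if "prime q" "q dvd ord h" for q
    using exists_power_of_prime_order[OF assms(1) h that] assms(5)[of q "h [^] (ord h div q)"] pow that
    by blast
  moreover have "ord h > 0" using ord_ge_1[OF assms(1) h] by simp
  ultimately obtain k where "ord h = p ^ k"
    using prime_power_if_unique_prime_divisor assms(3) by blast
  then show ?thesis using pow_ord_eq_1[OF h] by (auto simp: p_element_def)
qed

text \<open>If another prime \<open>q\<close> divided the order of \<open>H\<close>, Sylow's theorem
  with exponent one would supply a subgroup of order \<open>q\<close>, whose nontrivial elements are
  not p-elements.\<close>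

lemma p_group_if_p_elements:
  assumes fin: "finite (carrier G)" and H: "subgroup H G" and p: "prime p"
    and el: "\<And>h. h \<in> H \<Longrightarrow> p_element p h"
  shows "p_group p (G\<lparr>carrier := H\<rparr>)"
proof -
  interpret H: group "G\<lparr>carrier := H\<rparr>" by (rule subgroup_imp_group[OF H])
  have Hfin: "finite H" using fin subgroup.subset[OF H] finite_subset by blast
  then have "card H > 0" using subgroup.one_closed[OF H] card_gt_0_iff by blast
  moreover have "q = p" if q: "prime q" "q dvd card H" for q
  proof (rule ccontr)
    assume "q \<noteq> p"
    obtain m where "card H = q ^ 1 * m" using q by auto
    then obtain K where K: "subgroup K (G\<lparr>carrier := H\<rparr>)" "card K = q"
      using sylow_thm[OF q(1) H.is_group, of 1 m] Hfin by (auto simp: order_def)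
    then have KG: "subgroup K G" using incl_subgroup[OF H] by blast
    interpret K: group "G\<lparr>carrier := K\<rparr>" by (rule subgroup_imp_group[OF KG])
    have "K \<noteq> {\<one>}" using K q by auto
    then obtain u where u: "u \<in> K" "u \<noteq> \<one>" using subgroup.one_closed[OF KG] by auto
    have uc: "u \<in> carrier G" "u \<in> H"
      using u subgroup.subset[OF KG] subgroup.subset[OF K(1)] by auto
    have "u [^]\<^bsub>G\<lparr>carrier := K\<rparr>\<^esub> q = \<one>"
      using K.pow_order_eq_1[of u] u K(2) by (simp add: order_def)
    then have "u [^] q = \<one>" by (simp flip: nat_pow_consistent)
    then have "p_element q u" by (auto simp: p_element_def intro!: exI[of _ 1])
    then show False
      using p_element_distinct_primes[OF uc(1) el[OF uc(2)]] p q(1) \<open>q \<noteq> p\<close> u(2) by blast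
  qed
  ultimately show ?thesis
    using prime_power_if_unique_prime_divisor[of "card H" p] p H.is_group
    by (auto simp: p_group_def order_def)
qed

text \<open>A nontrivial subnormal subgroup \<open>S\<close> of least order has no proper nontrivial
  normal subgroup. It is not quasisimple, hence not perfect, hence abelian. Its elements of p-power
  order, for a prime \<open>p\<close> dividing the order of some element, form a normal subgroup
  \<open>N\<close> of \<open>S\<close>, and p-cores of subnormal subgroups lie in the p-core of
  \<open>H\<close>.\<close>

lemma nontrivial_p_core:
  assumes fin: "finite (carrier G)" and H: "subgroup H G" "H \<noteq> {\<one>}"
    and nq: "\<And>L. \<lbrakk>subnormal (G\<lparr>carrier := H\<rparr>) L; quasisimple_in L\<rbrakk> \<Longrightarrow> False"
  shows "\<exists>p. prime p \<and> p_core p H \<noteq> {\<one>}"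
proof -
  let ?P = "\<lambda>S. subnormal (G\<lparr>carrier := H\<rparr>) S \<and> S \<noteq> {\<one>}"
  have "?P H" using H by (simp add: subnormal_in_whole)
  then obtain S where S: "subnormal (G\<lparr>carrier := H\<rparr>) S" "S \<noteq> {\<one>}"
    and min: "\<And>T. ?P T \<Longrightarrow> card S \<le> card T"
    using ex_has_least_nat[of ?P H card] by auto
  have Ssub: "subgroup S G" "S \<subseteq> H" by (rule subnormal_in_subgroup[OF H(1) S(1)])+
  have Sc: "a \<in> carrier G" if "a \<in> S" for a using Ssub(1) that by (rule subgroup.mem_carrier)
  have Sfin: "finite S" by (rule finite_subset[OF subgroup.subset[OF Ssub(1)] fin])
  have simple: "N = S \<or> N = {\<one>}" if "normal_in N S" for N
    using min[of N] subnormal_in_step[OF S(1) that] card_seteq[OF Sfin normal_inD(3)[OF that]] by auto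
  have "normal_in (derived G S) S"
    using derived_subgroup_is_normal[OF Ssub(1)] normal_in_iff_normal[OF Ssub(1)] by simp
  moreover have "derived G S \<noteq> S"
  proof
    assume "derived G S = S"
    moreover have "{\<one>} \<subseteq> centralizer S S"
      using subgroup.one_closed[OF Ssub(1)] Sc by (simp add: centralizer_def)
    ultimately have "quasisimple_in S"
      using Ssub S(2) simple unfolding quasisimple_in_def by blast
    then show False using nq S(1) by blast
  qed
  ultimately have D: "derived G S = {\<one>}" using simple by blast
  have comm: "a \<otimes> b = b \<otimes> a" if "a \<in> S" "b \<in> S" for a b
  proof -
    have "a \<otimes> b \<otimes> inv a \<otimes> inv b \<in> derived G S"
      unfolding derived_def by (rule generate.incl) (use that in auto)
    then show ?thesis using D that Sc commute_if_commutator_eq_one by blast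
  qed
  obtain s where s: "s \<in> S" "s \<noteq> \<one>" using S(2) subgroup.one_closed[OF Ssub(1)] by auto
  then have "ord s \<noteq> 1" using ord_eq_1 Sc by blast
  then obtain p where p: "prime p" "p dvd ord s" using prime_factor_nat by blast
  define u where "u = s [^] (ord s div p)"
  have u: "u \<noteq> \<one>" "u [^] p = \<one>"
    unfolding u_def using exists_power_of_prime_order[OF fin Sc[OF s(1)] p] by auto
  have uS: "u \<in> S" unfolding u_def
    using Ssub(1) s(1) by (rule subgroup_nat_pow_closed)
  define N where "N = {a \<in> S. p_element p a}"
  have "normal_in N S"
  proof (rule normal_inI)
    show "subgroup N G"
    proof (rule subgroupI)
      show "N \<noteq> {}" using subgroup.one_closed[OF Ssub(1)] by (auto simp: N_def)
    next
      fix a assume "a \<in> N" then show "inv a \<in> N"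
        using Sc Ssub by (auto simp: N_def p_element_def nat_pow_inv subgroup.m_inv_closed)
    next
      fix a b assume ab: "a \<in> N" "b \<in> N"
      then obtain i j where "a [^] (p ^ i) = \<one>" "b [^] (p ^ j) = \<one>"
        by (auto simp: N_def p_element_def)
      then have "a [^] (p ^ (i + j)) = \<one>" "b [^] (p ^ (j + i)) = \<one>"
        using ab Sc by (auto simp: N_def power_add simp flip: nat_pow_pow)
      then have "(a \<otimes> b) [^] (p ^ (i + j)) = \<one>"
        using pow_mult_distrib[OF comm, of a b] ab Sc by (auto simp: N_def add.commute)
      then show "a \<otimes> b \<in> N" using ab Ssub
        by (auto simp: N_def p_element_def subgroup.m_closed)
    qed (use Sc in \<open>auto simp: N_def\<close>)
  qed (use Ssub Sc in \<open>auto simp: N_def p_element_conj_by conj_by_mem\<close>)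
  then have "N \<subseteq> p_core p S" by (rule p_core_upper) (simp add: N_def)
  also have "\<dots> \<subseteq> p_core p H" by (rule p_core_subnormal[OF H(1) S(1)])
  finally have "N \<subseteq> p_core p H" .
  moreover have "u \<in> N" using uS u(2) by (auto simp: N_def p_element_def intro!: exI[of _ 1])
  ultimately show ?thesis using u(1) p(1) by auto
qed

section \<open>The upper central series and nilpotent normal subgroups\<close>

primrec upper_central :: "'a set \<Rightarrow> nat \<Rightarrow> 'a set" where
  "upper_central N 0 = {\<one>}"
| "upper_central N (Suc n) = {a \<in> N. \<forall>b\<in>N. a \<otimes> b \<otimes> inv a \<otimes> inv b \<in> upper_central N n}"

lemma upper_central_normal_in:
  assumes N: "subgroup N G"
  shows "normal_in (upper_central N n) N"
proof (induction n)
  case 0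
  then show ?case using N by (simp add: normal_in_triv)
next
  case (Suc n)
  let ?U = "upper_central N n"
  note U = normal_inD[OF Suc]
  have c: "a \<in> carrier G" if "a \<in> N" for a using N that by (rule subgroup.mem_carrier)
  show ?case
  proof (rule normal_inI)
    show "subgroup (upper_central N (Suc n)) G"
    proof (rule subgroupI)
      have "\<one> \<in> upper_central N (Suc n)"
        using c subgroup.one_closed[OF N] subgroup.one_closed[OF U(1)] by simp
      then show "upper_central N (Suc n) \<noteq> {}" by blast
    next
      fix a assume a: "a \<in> upper_central N (Suc n)"
      have "inv a \<otimes> b \<otimes> inv (inv a) \<otimes> inv b \<in> ?U" if b: "b \<in> N" for b
      proof -
        have "inv (a \<otimes> b \<otimes> inv a \<otimes> inv b) \<in> ?U"
          using a b U(1) by (auto intro: subgroup.m_inv_closed)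
        then have "conj_by (inv a) (inv (a \<otimes> b \<otimes> inv a \<otimes> inv b)) \<in> ?U"
          using U(6) a N by (auto intro: subgroup.m_inv_closed)
        then show ?thesis using a b c by (simp add: conj_by_def group_word_simps)
      qed
      then show "inv a \<in> upper_central N (Suc n)" using a N by (auto intro: subgroup.m_inv_closed)
    next
      fix a a' assume a: "a \<in> upper_central N (Suc n)" "a' \<in> upper_central N (Suc n)"
      have "a \<otimes> a' \<otimes> b \<otimes> inv (a \<otimes> a') \<otimes> inv b \<in> ?U" if b: "b \<in> N" for b
      proof -
        have "conj_by a (a' \<otimes> b \<otimes> inv a' \<otimes> inv b) \<otimes> (a \<otimes> b \<otimes> inv a \<otimes> inv b) \<in> ?U"
          by (rule subgroup.m_closed[OF U(1) U(6)]) (use a b in auto)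
        then show ?thesis using a b c by (simp add: conj_by_def group_word_simps)
      qed
      then show "a \<otimes> a' \<in> upper_central N (Suc n)" using a N by (auto intro: subgroup.m_closed)
    qed (use c in auto)
  next
    fix k a assume k: "k \<in> N" and a: "a \<in> upper_central N (Suc n)"
    have "conj_by k a \<otimes> b \<otimes> inv (conj_by k a) \<otimes> inv b \<in> ?U" if b: "b \<in> N" for b
    proof -
      have "conj_by (inv k) b \<in> N" using k b N by (simp add: conj_by_mem subgroup.m_inv_closed)
      then have "conj_by k (a \<otimes> conj_by (inv k) b \<otimes> inv a \<otimes> inv (conj_by (inv k) b)) \<in> ?U"
        using U(6) a k by auto
      then show ?thesis using a b c k by (simp add: conj_by_def group_word_simps)
    qed
    then show "conj_by k a \<in> upper_central N (Suc n)" using a k N by (simp add: conj_by_mem)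
  qed (use N in auto)
qed

lemma lower_central_subset:
  assumes "group A"
  shows "lower_central A n \<subseteq> carrier A"
proof -
  interpret A: group A by fact
  show ?thesis
  proof (induction n)
    case (Suc n)
    then show ?case unfolding lower_central.simps by (intro A.generate_incl) (auto simp: subset_iff)
  qed simp
qed

text \<open>Read from its trivial end, the lower central series stays below the upper one, because
  each term has its commutators with \<open>N\<close> in the term before. At \<open>i = n\<close>
  all of \<open>N\<close> lies in \<open>upper_central N n\<close>.\<close>

lemma lower_central_le_upper_central:
  assumes N: "subgroup N G" and triv: "lower_central (G\<lparr>carrier := N\<rparr>) n = {\<one>}" and "i \<le> n"
  shows "lower_central (G\<lparr>carrier := N\<rparr>) (n - i) \<subseteq> upper_central N i"
  using \<open>i \<le> n\<close>
proof (induction i)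
  case 0
  then show ?case using triv by simp
next
  case (Suc i)
  let ?L = "lower_central (G\<lparr>carrier := N\<rparr>)"
  have eq: "n - i = Suc (n - Suc i)" using Suc by simp
  have L: "?L (n - Suc i) \<subseteq> N"
    using lower_central_subset[OF subgroup_imp_group[OF N], of "n - Suc i"] by simp
  have "h \<otimes> a \<otimes> inv h \<otimes> inv a \<in> ?L (n - i)" if "h \<in> ?L (n - Suc i)" "a \<in> N" for h a
    unfolding eq lower_central.simps
    by (rule generate.incl, rule UN_I[OF that(1)], rule UN_I[of a])
      (use that L N in \<open>auto simp: m_inv_consistent\<close>)
  then show ?case using Suc L by auto
qed

text \<open>For \<open>a\<close> in the term \<open>i + 2\<close>, its commutator with
  \<open>b\<close> lies in the term \<open>i + 1\<close> and so is central modulo the term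
  \<open>i\<close>. Hence taking the commutator with \<open>b\<close> is compatible with powers of
  \<open>a\<close>, up to a factor \<open>w\<close> in the term \<open>i\<close>.\<close>

lemma commutator_pow_mod:
  assumes N: "subgroup N G" and a: "a \<in> upper_central N (Suc (Suc i))" and b: "b \<in> N"
  shows "\<exists>w\<in>upper_central N i. a [^] (m::nat) \<otimes> b \<otimes> inv (a [^] m) \<otimes> inv b
    = w \<otimes> (a \<otimes> b \<otimes> inv a \<otimes> inv b) [^] m"
proof (induction m)
  case 0
  have "b \<in> carrier G" using N b by (rule subgroup.mem_carrier)
  then show ?case
    using subgroup.one_closed[OF normal_inD(1)[OF upper_central_normal_in[OF N, of i]]]
    by (auto intro!: bexI[of _ \<one>])
next
  case (Suc m)
  let ?U = "upper_central N i"
  define d where "d = a \<otimes> b \<otimes> inv a \<otimes> inv b"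
  define x where "x = a [^] m"
  note U = normal_inD[OF upper_central_normal_in[OF N, of i]]
  have aN: "a \<in> N" using a by simp
  have c: "a \<in> carrier G" "b \<in> carrier G" using N aN b by (auto intro: subgroup.mem_carrier)
  then have dx: "d \<in> carrier G" "x \<in> carrier G" by (auto simp: d_def x_def)
  have xN: "x \<in> N"
    unfolding x_def using N aN by (rule subgroup_nat_pow_closed)
  have dU: "d \<in> upper_central N (Suc i)" using a b by (simp add: d_def)
  then have "d \<otimes> x \<otimes> inv d \<otimes> inv x \<in> ?U" using xN by auto
  then have w1: "inv (d \<otimes> x \<otimes> inv d \<otimes> inv x) \<in> ?U" using U(1) by (rule subgroup.m_inv_closed[rotated])
  obtain w where w: "w \<in> ?U" "x \<otimes> b \<otimes> inv x \<otimes> inv b = w \<otimes> d [^] m"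
    using Suc by (auto simp: d_def x_def)
  have dN: "d \<in> N" using dU by simp
  \<comment> \<open>With \<open>x = a [^] m\<close>, the commutator of \<open>x \<otimes> a\<close>
    with \<open>b\<close> is the conjugate of \<open>d\<close> by \<open>x\<close>, times the
    commutator of \<open>x\<close> with \<open>b\<close>. The factor \<open>w'\<close> absorbs the
    commutator of \<open>d\<close> and \<open>x\<close> and moves \<open>w\<close> past
    \<open>d\<close>.\<close>
  define w' where "w' = inv (d \<otimes> x \<otimes> inv d \<otimes> inv x) \<otimes> conj_by d w"
  have w': "w' \<in> ?U" unfolding w'_def using w1 U(6)[OF dN w(1)] U(1) by (intro subgroup.m_closed)
  have wc: "w \<in> carrier G" using w U by auto
  have "a [^] Suc m \<otimes> b \<otimes> inv (a [^] Suc m) \<otimes> inv b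
      = (x \<otimes> d \<otimes> inv x) \<otimes> (x \<otimes> b \<otimes> inv x \<otimes> inv b)"
    using c dx unfolding x_def[symmetric] d_def nat_pow_Suc by (simp add: group_word_simps)
  also have "\<dots> = (x \<otimes> d \<otimes> inv x) \<otimes> (w \<otimes> d [^] m)" by (simp only: w)
  also have "\<dots> = w' \<otimes> (d \<otimes> d [^] m)"
    using dx wc by (simp add: w'_def conj_by_def group_word_simps)
  also have "d \<otimes> d [^] m = d [^] Suc m" by (rule nat_pow_Suc2[OF dx(1), symmetric])
  finally show ?case using w' by (auto simp: d_def)
qed

text \<open>For a prime \<open>q\<close> other than \<open>p\<close>, the factors of the upper
  central series of \<open>N\<close> contain no element of order \<open>q\<close>. An element
  \<open>u\<close> with \<open>u [^] q = \<one>\<close> therefore descends through the whole series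
  to the identity.\<close>

lemma normal_nilpotent_p_element:
  assumes fin: "finite (carrier G)" and p: "prime p" and N: "normal_in N B"
    and nil: "nilpotent_group (G\<lparr>carrier := N\<rparr>)"
    and core: "\<And>q. \<lbrakk>prime q; q \<noteq> p\<rbrakk> \<Longrightarrow> p_core q B \<subseteq> {\<one>}"
    and n: "n \<in> N"
  shows "p_element p n"
proof (rule p_element_if_no_other_prime_order[OF fin normal_inD(1)[OF N] p n])
  fix q u assume q: "prime q" "q \<noteq> p" and u: "u \<in> N" "u [^] q = \<one>"
  note N' = normal_inD[OF N]
  have c: "a \<in> carrier G" if "a \<in> N" for a using that N'(4) by blast
  let ?U = "upper_central N"
  \<comment> \<open>The elements of the centre of \<open>N\<close> with trivial q-th power form a
    subgroup \<open>M\<close>. It is normal even in \<open>B\<close>, since the centre of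
    \<open>N\<close> is \<open>N\<close> intersected with the centraliser of \<open>N\<close> in
    \<open>B\<close>; so it lies in the trivial q-core of \<open>B\<close>.\<close>
  have base: "a = \<one>" if a: "a \<in> ?U (Suc 0)" "a [^] q = \<one>" for a
  proof -
    define M where "M = {z \<in> centralizer N N. z [^] q = \<one>}"
    have Z: "normal_in (centralizer N N) B"
    proof -
      have "normal_in (centralizer B N) B"
        by (rule centralizer_normal_in) (use N' in auto)
      moreover have "centralizer N N = N \<inter> centralizer B N" using N' by (auto simp: centralizer_def)
      ultimately show ?thesis using normal_in_Int2[OF N] by simp
    qed
    note Z' = normal_inD[OF Z]
    have zz: "z \<otimes> z' = z' \<otimes> z" if "z \<in> centralizer N N" "z' \<in> centralizer N N" for z z'
      using that unfolding centralizer_def by blast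
    have "normal_in M B"
    proof (rule normal_inI)
      show "subgroup M G"
      proof (rule subgroupI)
        show "M \<noteq> {}" using subgroup.one_closed[OF Z'(1)] by (auto simp: M_def intro!: exI[of _ \<one>])
      next
        fix z assume "z \<in> M" then show "inv z \<in> M"
          using Z' by (auto simp: M_def nat_pow_inv subset_iff subgroup.m_inv_closed)
      next
        fix z z' assume z: "z \<in> M" "z' \<in> M"
        then have "(z \<otimes> z') [^] q = \<one>"
          using Z'(4) pow_mult_distrib[OF zz, of z z' q] by (auto simp: M_def)
        then show "z \<otimes> z' \<in> M" using z Z'(1) by (auto simp: M_def subgroup.m_closed)
      qed (use Z' in \<open>auto simp: M_def\<close>)
      fix k h assume k: "k \<in> B" and h: "h \<in> M"
      have kh: "k \<in> carrier G" "h \<in> carrier G" using k h Z' by (auto simp: M_def)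
      have "conj_by k h [^] q = \<one>" using h kh conj_by_nat_pow[OF kh, of q] by (simp add: M_def)
      then show "conj_by k h \<in> M" using Z'(6)[OF k] h by (simp add: M_def)
    qed (use Z' in \<open>auto simp: M_def\<close>)
    then have "M \<subseteq> p_core q B"
      by (rule p_core_upper) (auto simp: M_def p_element_def intro!: exI[of _ 1])
    moreover have "a \<in> M"
    proof -
      have "a \<otimes> b = b \<otimes> a" if b: "b \<in> N" for b
      proof -
        have "a \<in> N" "a \<otimes> b \<otimes> inv a \<otimes> inv b = \<one>" using a b by simp_all
        then show ?thesis using commute_if_commutator_eq_one b c by blast
      qed
      then have "a \<in> centralizer N N" using a(1) unfolding centralizer_def by simp
      then show ?thesis using a(2) by (simp add: M_def)
    qed
    ultimately show ?thesis using core[OF q] by blast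
  qed
  \<comment> \<open>The absence of elements of order \<open>q\<close> moves up one factor: if the
    q-th power of \<open>a\<close> drops a level, then by \<open>commutator_pow_mod\<close> so do
    the q-th powers of the commutators of \<open>a\<close> with \<open>N\<close>. By induction the
    commutators themselves drop, and hence so does \<open>a\<close>.\<close>
  have step: "\<forall>a. a \<in> ?U (Suc i) \<and> a [^] q \<in> ?U i \<longrightarrow> a \<in> ?U i" for i
  proof (induction i)
    case 0
    then show ?case using base unfolding upper_central.simps(1) by blast
  next
    case (Suc i)
    note U = normal_inD[OF upper_central_normal_in[OF N'(1), of i]]
    show ?case
    proof (intro allI impI)
      fix a assume a: "a \<in> ?U (Suc (Suc i)) \<and> a [^] q \<in> ?U (Suc i)"
      have "a \<otimes> b \<otimes> inv a \<otimes> inv b \<in> ?U i" if b: "b \<in> N" for b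
      proof -
        let ?d = "a \<otimes> b \<otimes> inv a \<otimes> inv b"
        have d: "?d \<in> ?U (Suc i)" using a b by simp
        then have dc: "?d \<in> carrier G" using c by simp
        obtain w where w: "w \<in> ?U i"
          "a [^] q \<otimes> b \<otimes> inv (a [^] q) \<otimes> inv b = w \<otimes> ?d [^] q"
          using commutator_pow_mod[OF N'(1) conjunct1[OF a] b, of q] by blast
        have "w \<otimes> ?d [^] q \<in> ?U i" using a b unfolding w(2)[symmetric] by simp
        then have "inv w \<otimes> (w \<otimes> ?d [^] q) \<in> ?U i"
          by (rule subgroup.m_closed[OF U(1) subgroup.m_inv_closed[OF U(1) w(1)]])
        then have "?d [^] q \<in> ?U i"
          using inv_mult_cancel_left(1)[OF subsetD[OF U(4) w(1)] nat_pow_closed[OF dc]] by simp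
        then show ?thesis using Suc d by blast
      qed
      then show "a \<in> ?U (Suc i)" using a by simp
    qed
  qed
  have "u \<in> ?U i \<longrightarrow> u = \<one>" for i
  proof (induction i)
    case (Suc i)
    have "u [^] q \<in> ?U i"
      unfolding u(2) by (rule subgroup.one_closed[OF normal_inD(1)[OF upper_central_normal_in[OF N'(1)]]])
    then show ?case using step[of i] Suc by blast
  qed simp
  moreover obtain m where "lower_central (G\<lparr>carrier := N\<rparr>) m = {\<one>}"
    using nil by (auto simp: nilpotent_group_def)
  then have "N \<subseteq> ?U m"
    using lower_central_le_upper_central[OF N'(1), of m m] by simp
  ultimately show "u = \<one>" using u by blast
qed

text \<open>Without components the layer is trivial. Every nilpotent normal subgroup of
  \<open>B\<close> consists of p-elements, so the Fitting subgroup lies in the p-core.\<close>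

lemma p_group_generalised_fitting:
  assumes fin: "finite (carrier G)" and p: "prime p" and B: "subgroup B G"
    and core: "\<And>q. \<lbrakk>prime q; q \<noteq> p\<rbrakk> \<Longrightarrow> p_core q B \<subseteq> {\<one>}"
    and nq: "\<And>L. \<lbrakk>subnormal (G\<lparr>carrier := B\<rparr>) L; quasisimple_in L\<rbrakk> \<Longrightarrow> False"
  shows "p_group p (G\<lparr>carrier := generalised_fitting_subgroup (G\<lparr>carrier := B\<rparr>)\<rparr>)"
proof -
  define U where "U = \<Union>{N. N \<lhd> G\<lparr>carrier := B\<rparr> \<and> nilpotent_group (G\<lparr>carrier := N\<rparr>)}"
  have "{C. group_component (G\<lparr>carrier := B\<rparr>) C} = {}"
    using nq quasisimple_group_imp_in subnormal_in_subgroup[OF B]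
    by (fastforce simp: group_component_def)
  then have layer: "layer (G\<lparr>carrier := B\<rparr>) = {\<one>}"
    using group.generate_empty[OF subgroup_imp_group[OF B]] by (simp add: layer_def)
  have U: "U \<subseteq> p_core p B"
    using normal_nilpotent_p_element[OF fin p _ _ core] p_core_upper[of _ B p]
    by (fastforce simp: U_def normal_in_iff_normal[OF B, symmetric])
  note C = normal_inD[OF p_core_normal_in[OF B, of p]]
  have fit: "fitting_subgroup (G\<lparr>carrier := B\<rparr>) = generate G U"
    using U C(3) generate_consistent[OF _ B, of U] by (simp add: fitting_subgroup_def U_def)
  have gen: "subgroup (generate G U) G" "generate G U \<subseteq> p_core p B"
    using U C(4) generate_subgroup_incl[OF U C(1)] by (auto intro!: generate_is_subgroup)
  have "generalised_fitting_subgroup (G\<lparr>carrier := B\<rparr>) = generate G U"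
    using subgroup.mem_carrier[OF gen(1)]
    by (auto simp: generalised_fitting_subgroup_def fit layer set_mult_def)
  moreover have "p_group p (G\<lparr>carrier := generate G U\<rparr>)"
    by (rule p_group_if_p_elements[OF fin gen(1) p]) (use gen(2) p_core_p_element[of _ p B] in blast)
  ultimately show ?thesis by simp
qed

end

section \<open>The amalgam of an arc\<close>

context group
begin

lemma conj_by_image_comp:
  "\<lbrakk>g \<in> carrier G; h \<in> carrier G; S \<subseteq> carrier G\<rbrakk>
    \<Longrightarrow> conj_by (g \<otimes> h) ` S = conj_by g ` conj_by h ` S"
  unfolding image_image by (rule image_cong) (auto simp: conj_by_comp subset_iff)

lemma p_core_conj_by_eq:
  assumes g: "g \<in> carrier G" and H: "subgroup H G"
  shows "p_core p (conj_by g ` H) = conj_by g ` p_core p H"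
proof
  have Hc: "H \<subseteq> carrier G" and H': "subgroup (conj_by g ` H) G"
    using subgroup.subset[OF H] subgroup_conj_by[OF g H] by simp_all
  have "conj_by (inv g) ` p_core p (conj_by g ` H) \<subseteq> p_core p H"
    using p_core_conj_by[OF inv_closed[OF g] H', of p] conj_by_image_inv_cancel(1)[OF g Hc] by simp
  from image_mono[OF this, of "conj_by g"]
  show "p_core p (conj_by g ` H) \<subseteq> conj_by g ` p_core p H"
    using conj_by_image_inv_cancel(2)[OF g normal_inD(4)[OF p_core_normal_in[OF H']]] by simp
qed (rule p_core_conj_by[OF g H])

text \<open>Wielandt: a normal \<open>p\<close>-subgroup normalises \<open>O\<^sup>p\<close> of every subnormal subgroup, here of
  defect two. Instead of \<open>O\<^sup>p(N)\<close> it suffices to consider the \<open>p'\<close>-elements generating it.\<close>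

lemma normal_p_subgroup_conj_coprime_order:
  assumes NM: "normal_in N M" and MH: "normal_in M H" and PH: "normal_in P H"
    and P: "\<And>g. g \<in> P \<Longrightarrow> p_element p g"
    and g: "g \<in> P" and n: "n \<in> N" "n [^] (m::nat) = \<one>" "coprime m p"
  shows "conj_by g n \<in> N"
proof -
  note N' = normal_inD[OF NM] and M' = normal_inD[OF MH] and P' = normal_inD[OF PH]
  have nM: "n \<in> M" and nH: "n \<in> H" using n(1) N'(3) M'(3) by auto
  have c: "n \<in> carrier G" "g \<in> carrier G" using nM M'(4) g P'(4) by auto
  define u where "u = conj_by g n"
  \<comment> \<open>\<open>d\<close> is the commutator of \<open>inv n\<close> and \<open>g\<close>:
    it is in \<open>M\<close> because \<open>n\<close> and \<open>u\<close> are, and in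
    \<open>P\<close> because \<open>P\<close> is normal, which makes it a p-element. As
    \<open>u\<close> agrees with \<open>d\<close> modulo \<open>N\<close>, a p-power of
    \<open>u\<close> falls into \<open>N\<close>.\<close>
  define d where "d = inv n \<otimes> u"
  have uc: "u \<in> carrier G" using c by (simp add: u_def)
  have u: "u = n \<otimes> d" using c uc by (simp add: d_def inv_mult_cancel_left)
  have "u \<in> M" unfolding u_def using M'(6)[OF _ nM] g P'(3) by blast
  then have dM: "d \<in> M"
    unfolding d_def using nM M'(1) by (intro subgroup.m_closed[OF M'(1)] subgroup.m_inv_closed[OF M'(1)])
  have "conj_by (inv n) g \<in> P" by (rule P'(6)[OF subgroup.m_inv_closed[OF P'(2) nH] g])
  then have "conj_by (inv n) g \<otimes> inv g \<in> P"
    by (rule subgroup.m_closed[OF P'(1) _ subgroup.m_inv_closed[OF P'(1) g]])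
  moreover have "conj_by (inv n) g \<otimes> inv g = d"
    using c by (simp add: d_def u_def conj_by_def group_word_simps)
  ultimately obtain k where k: "d [^] (p ^ k) = \<one>" using P by (auto simp: p_element_def)
  obtain n' where n': "n' \<in> N" "u [^] (p ^ k) = n' \<otimes> d [^] (p ^ k)"
    using normal_in_mult_pow[OF NM n(1) dM, of "p ^ k"] u by blast
  then have uN: "u [^] (p ^ k) \<in> N" using k N'(4) by (auto simp: subset_iff)
  have um: "u [^] m = \<one>" using c n(2) by (simp add: u_def flip: conj_by_nat_pow)
  show ?thesis
  \<comment> \<open>\<open>p\<close> is not assumed prime. For \<open>p = 0\<close> coprimality
    forces \<open>m = 1\<close>; otherwise Bezout's identity writes \<open>u\<close> as a power of
    \<open>u [^] (p ^ k)\<close>, because \<open>u [^] m = \<one>\<close>.\<close>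
  proof (cases "p ^ k = 0")
    case True
    then have "m = 1" using n(3) by simp
    then show ?thesis using um uc N'(1) by (simp add: u_def subgroup.one_closed)
  next
    case False
    have "coprime (p ^ k) m" using n(3) by (simp add: coprime_commute)
    then obtain x y where "p ^ k * x = m * y + 1"
      using bezout_nat[OF False, of m] by (auto simp: coprime_iff_gcd_eq_1)
    then have "(u [^] (p ^ k)) [^] x = (u [^] m) [^] y \<otimes> u"
      using uc by (simp add: nat_pow_pow flip: nat_pow_mult)
    then have "u = (u [^] (p ^ k)) [^] x" using uc um by simp
    also have "\<dots> \<in> N" by (rule subgroup_nat_pow_closed[OF N'(1) uN])
    finally show ?thesis by (simp add: u_def)
  qed
qed

end

text \<open>The group theory of an arc \<open>(x, y)\<close>: \<open>X\<close>, \<open>Y\<close> are the vertex stabilisers and \<open>Q\<close>, \<open>R\<close> their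
  kernels on the neighbourhoods, \<open>t\<close> reverses the arc, and \<open>TX N\<close> says that \<open>N\<close> is transitive on the
  neighbours of \<open>x\<close>.\<close>

locale semiprimitive_amalgam = group G for G :: "('a, 'b) monoid_scheme" (structure) +
  fixes X Y Q R :: "'a set" and t :: 'a and TX TY :: "'a set \<Rightarrow> bool"
  assumes fin: "finite (carrier G)"
    and Q_normal: "normal_in Q X" and R_normal: "normal_in R Y"
    and Q_sub: "Q \<subseteq> Y" and R_sub: "R \<subseteq> X"
    and t: "t \<in> carrier G"
    and t_X: "conj_by t ` X = Y" and t_Y: "conj_by t ` Y = X"
    and t_Q: "conj_by t ` Q = R" and t_R: "conj_by t ` R = Q"
    and TX_whole: "TX X" and TY_whole: "TY Y"
    and semiprimitive_X: "\<lbrakk>normal_in N X; \<not> N \<inter> Y \<subseteq> Q\<rbrakk> \<Longrightarrow> TX N"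
    and semiprimitive_Y: "\<lbrakk>normal_in N Y; \<not> N \<inter> X \<subseteq> R\<rbrakk> \<Longrightarrow> TY N"
    and edge_transitive_faithful: "\<lbrakk>normal_in N X; normal_in M Y; TX N; TY M; S \<subseteq> X \<inter> Y;
      \<And>g s. g \<in> N \<union> M \<Longrightarrow> s \<in> S \<Longrightarrow> conj_by g s \<in> S\<rbrakk> \<Longrightarrow> S \<subseteq> {\<one>}"
begin

text \<open>The assumptions are symmetric in the two ends of the arc, with the same
  \<open>t\<close>; each result about \<open>X\<close> and \<open>Q\<close> thus yields one about
  \<open>Y\<close> and \<open>R\<close>.\<close>

lemma swap: "semiprimitive_amalgam G Y X R Q t TY TX"
proof unfold_locales
  fix N M S
  assume *: "normal_in N Y" "normal_in M X" "TY N" "TX M" "S \<subseteq> Y \<inter> X"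
    "\<And>g s. g \<in> N \<union> M \<Longrightarrow> s \<in> S \<Longrightarrow> conj_by g s \<in> S"
  show "S \<subseteq> {\<one>}"
    by (rule edge_transitive_faithful[OF *(2,1,4,3)]) (use *(5,6) in auto)
qed (fact fin Q_normal R_normal Q_sub R_sub t t_X t_Y t_Q t_R TX_whole TY_whole
  semiprimitive_X semiprimitive_Y)+

lemmas X = normal_inD(2)[OF Q_normal] and Y = normal_inD(2)[OF R_normal]
  and Q = normal_inD(1)[OF Q_normal] and R = normal_inD(1)[OF R_normal]

lemma arc_subgroup: "subgroup (X \<inter> Y) G"
  by (rule subgroups_Inter_pair[OF X Y])

lemma kernel_normal_in_arc: "normal_in Q (X \<inter> Y)"
  by (rule normal_in_mono[OF Q_normal arc_subgroup]) (use normal_inD(3)[OF Q_normal] Q_sub in auto)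

lemma arc_kernel_normal_in: "normal_in (Q \<inter> R) (X \<inter> Y)"
  using normal_in_Int2[OF kernel_normal_in_arc, of R] semiprimitive_amalgam.kernel_normal_in_arc[OF swap]
  by (simp add: Int_commute[of Y X])

lemma arc_kernel_normal_in_kernel: "normal_in (Q \<inter> R) Q"
  by (rule normal_in_mono[OF arc_kernel_normal_in Q]) (use normal_inD(3)[OF Q_normal] Q_sub in auto)

lemma not_mem_kernel_swap:
  assumes "a \<in> X" "a \<notin> Q"
  shows "conj_by t a \<notin> R"
proof
  assume "conj_by t a \<in> R"
  then obtain b where b: "b \<in> Q" "conj_by t a = conj_by t b" using t_Q by auto
  have "a \<in> carrier G" "b \<in> carrier G"
    using assms b normal_inD(4,5)[OF Q_normal] by auto
  then have "a = b" using b(2) conj_by_inv_cancel(2)[OF t] by metis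
  then show False using b assms by simp
qed

section \<open>The centraliser of the kernel, and components of the arc stabiliser\<close>

lemma centralizer_transitive:
  assumes "\<not> centralizer (X \<inter> Y) Q \<subseteq> Q"
  shows "normal_in (centralizer X Q) X" "TX (centralizer X Q)"
proof -
  show n: "normal_in (centralizer X Q) X"
    by (rule centralizer_normal_in[OF X normal_inD(4,6)[OF Q_normal]])
  show "TX (centralizer X Q)"
    by (rule semiprimitive_X[OF n]) (use assms in \<open>unfold centralizer_def, blast\<close>)
qed

lemma conj_by_centralizer_eq:
  assumes "S \<subseteq> carrier G" "H \<subseteq> carrier G" "g \<in> centralizer H S" "s \<in> S"
  shows "conj_by g s = s"
proof -
  have "g \<otimes> s = s \<otimes> g" "g \<in> carrier G" "s \<in> carrier G"
    using assms unfolding centralizer_def by auto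
  then show ?thesis using conj_by_eq_self_iff by blast
qed

text \<open>Conjugation by \<open>t\<close> carries a violating element to the other end, so the
  centralisers of \<open>Q\<close> in \<open>X\<close> and of \<open>R\<close> in \<open>Y\<close>
  are both locally transitive. Both fix \<open>Q \<inter> R\<close> elementwise, which contradicts
  \<open>edge_transitive_faithful\<close>.\<close>

lemma centralizer_kernel:
  assumes K: "Q \<inter> R \<noteq> {\<one>}"
  shows "centralizer (X \<inter> Y) Q \<subseteq> Q"
proof (rule ccontr)
  assume nc: "\<not> centralizer (X \<inter> Y) Q \<subseteq> Q"
  then obtain a where a: "a \<in> X" "a \<in> Y" "a \<notin> Q" "\<And>q. q \<in> Q \<Longrightarrow> a \<otimes> q = q \<otimes> a"
    unfolding centralizer_def by blast
  have ac: "a \<in> carrier G" and Qc: "Q \<subseteq> carrier G" and Rc: "R \<subseteq> carrier G"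
    using a(1) normal_inD(4,5)[OF Q_normal] normal_inD(4)[OF R_normal] by auto
  have "conj_by t a \<otimes> r = r \<otimes> conj_by t a" if r: "r \<in> R" for r
  proof -
    obtain q where q: "q \<in> Q" "r = conj_by t q" using r t_Q by auto
    have qc: "q \<in> carrier G" using q(1) Qc by auto
    show ?thesis
      unfolding q(2) conj_by_mult[OF t ac qc, symmetric] conj_by_mult[OF t qc ac, symmetric] a(4)[OF q(1)] ..
  qed
  moreover have "conj_by t a \<in> X" "conj_by t a \<in> Y" using a(1,2) t_X t_Y by auto
  ultimately have "conj_by t a \<in> centralizer (Y \<inter> X) R" unfolding centralizer_def by blast
  then have ncR: "\<not> centralizer (Y \<inter> X) R \<subseteq> R" using not_mem_kernel_swap[OF a(1,3)] by blast
  have "Q \<inter> R \<subseteq> {\<one>}"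
  proof (rule edge_transitive_faithful)
    show "normal_in (centralizer X Q) X" "TX (centralizer X Q)"
      by (rule centralizer_transitive[OF nc])+
    show "normal_in (centralizer Y R) Y" "TY (centralizer Y R)"
      by (rule semiprimitive_amalgam.centralizer_transitive[OF swap ncR])+
    show "Q \<inter> R \<subseteq> X \<inter> Y" using normal_inD(3)[OF Q_normal] Q_sub by auto
    fix g s assume "g \<in> centralizer X Q \<union> centralizer Y R" "s \<in> Q \<inter> R"
    then show "conj_by g s \<in> Q \<inter> R"
      using conj_by_centralizer_eq[OF Qc normal_inD(5)[OF Q_normal]]
        conj_by_centralizer_eq[OF Rc normal_inD(5)[OF R_normal]] by fastforce
  qed
  then show False using K subgroup.one_closed[OF Q] subgroup.one_closed[OF R] by blast
qed

text \<open>\<open>X\<close> need not normalise \<open>X \<inter> Y\<close>, but it normalises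
  \<open>Q\<close>. Since \<open>L\<close> lies in \<open>Q\<close>, it is subnormal there; so are
  its conjugates under \<open>X\<close>, and \<open>Q\<close> is normal in
  \<open>X \<inter> Y\<close>.\<close>

lemma component_conj_by:
  assumes K: "Q \<inter> R \<noteq> {\<one>}"
    and L: "subnormal (G\<lparr>carrier := X \<inter> Y\<rparr>) L" "quasisimple_in L"
  shows "L \<subseteq> Q" "g \<in> X \<Longrightarrow> subnormal (G\<lparr>carrier := X \<inter> Y\<rparr>) (conj_by g ` L)"
proof -
  have LB: "L \<subseteq> X \<inter> Y" by (rule subnormal_in_subgroup[OF arc_subgroup L(1)])
  show LQ: "L \<subseteq> Q"
    using quasisimple_subnormal_cases[OF arc_subgroup L kernel_normal_in_arc]
  proof
    assume "\<forall>l\<in>L. \<forall>n\<in>Q. l \<otimes> n = n \<otimes> l"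
    then have "L \<subseteq> centralizer (X \<inter> Y) Q" using LB unfolding centralizer_def by blast
    then show ?thesis using centralizer_kernel[OF K] by simp
  qed
  assume g: "g \<in> X"
  have "subnormal (G\<lparr>carrier := Q\<rparr>) L"
    using subnormal_in_Int[OF arc_subgroup L(1) Q normal_inD(3)[OF kernel_normal_in_arc]] LQ
    by (simp add: Int_absorb2)
  then have "subnormal (G\<lparr>carrier := Q\<rparr>) (conj_by g ` L)"
    using subnormal_in_conj_by[OF _ Q, of g L] normal_in_conj_image[OF Q_normal g] g
      normal_inD(5)[OF Q_normal] by auto
  then show "subnormal (G\<lparr>carrier := X \<inter> Y\<rparr>) (conj_by g ` L)"
    by (rule subnormal_in_normal[OF kernel_normal_in_arc])
qed

lemma no_component:
  assumes K: "Q \<inter> R \<noteq> {\<one>}"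
    and L: "subnormal (G\<lparr>carrier := X \<inter> Y\<rparr>) L" "quasisimple_in L"
  shows False
proof -
  \<comment> \<open>The union of all components of \<open>X \<inter> Y\<close> is invariant under
    \<open>X\<close> and under \<open>Y\<close>. It need not be a subgroup, as
    \<open>edge_transitive_faithful\<close> accepts any subset.\<close>
  define U where "U = \<Union>{L. subnormal (G\<lparr>carrier := X \<inter> Y\<rparr>) L \<and> quasisimple_in L}"
  have K': "R \<inter> Q \<noteq> {\<one>}" using K by (simp add: Int_commute)
  have conjX: "subnormal (G\<lparr>carrier := X \<inter> Y\<rparr>) (conj_by g ` L)"
    if "subnormal (G\<lparr>carrier := X \<inter> Y\<rparr>) L" "quasisimple_in L" "g \<in> X \<union> Y" for g L
    using that(3)
  proof
    assume "g \<in> Y"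
    then show ?thesis
      using semiprimitive_amalgam.component_conj_by(2)[OF swap K', of L g] that(1,2)
      by (simp add: Int_commute)
  qed (rule component_conj_by(2)[OF K that(1,2)])
  have "U \<subseteq> {\<one>}"
  proof (rule edge_transitive_faithful[OF normal_in_refl[OF X] normal_in_refl[OF Y] TX_whole TY_whole])
    show "U \<subseteq> X \<inter> Y" using subnormal_in_subgroup(2)[OF arc_subgroup] by (auto simp: U_def)
  next
    fix g s assume g: "g \<in> X \<union> Y" and "s \<in> U"
    then obtain L where L: "subnormal (G\<lparr>carrier := X \<inter> Y\<rparr>) L" "quasisimple_in L" "s \<in> L"
      by (auto simp: U_def)
    have "g \<in> carrier G" using g normal_inD(5)[OF Q_normal] normal_inD(5)[OF R_normal] by auto
    then have "quasisimple_in (conj_by g ` L)" using quasisimple_in_conj_by L(2) by blast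
    then show "conj_by g s \<in> U" using conjX[OF L(1,2) g] L(3) by (auto simp: U_def)
  qed
  then have "L \<subseteq> {\<one>}" using L by (auto simp: U_def)
  moreover have "L \<noteq> {\<one>}" "\<one> \<in> L"
    using L(2) subgroup.one_closed unfolding quasisimple_in_def by blast+
  ultimately show False by blast
qed

section \<open>The p-cores of the two kernels and the choice of the prime\<close>

lemma p_core_swap: "p_core p R = conj_by t ` p_core p Q"
  using p_core_conj_by_eq[OF t Q, of p] t_Q by simp

lemma p_core_swap_trivial:
  assumes "p_core p Q \<noteq> {\<one>}"
  shows "p_core p R \<noteq> {\<one>}"
proof
  assume "p_core p R = {\<one>}"
  then have "conj_by t a = \<one>" if "a \<in> p_core p Q" for a
    using that p_core_swap[of p] by blast
  then have "p_core p Q \<subseteq> {\<one>}"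
    using conj_by_eq_one_iff[OF t] normal_inD(4)[OF p_core_normal_in[OF Q]] by blast
  then show False
    using assms subgroup.one_closed[OF normal_inD(1)[OF p_core_normal_in[OF Q, of p]]] by blast
qed

text \<open>If O_p(Q) were contained in \<open>R\<close>, it would be a normal p-subgroup of
  \<open>R\<close>, hence in O_p(R). Conjugation by \<open>t\<close> gives the reverse inclusion, so
  the two coincide and are normalised by both \<open>X\<close> and \<open>Y\<close>.\<close>

lemma p_core_not_le:
  assumes "p_core p Q \<noteq> {\<one>}"
  shows "\<not> p_core p Q \<subseteq> R"
proof
  assume le: "p_core p Q \<subseteq> R"
  have QX: "normal_in (p_core p Q) X" by (rule p_core_char[OF Q_normal])
  have "normal_in (p_core p Q) R" by (rule normal_in_mono[OF QX R le R_sub])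
  then have 1: "p_core p Q \<subseteq> p_core p R" by (rule p_core_upper) (rule p_core_p_element)
  from image_mono[OF 1, of "conj_by t"] have "p_core p R \<subseteq> p_core p Q"
    by (simp only: p_core_swap[symmetric] semiprimitive_amalgam.p_core_swap[OF swap, symmetric])
  with 1 have "p_core p Q = p_core p R" by simp
  then have QY: "normal_in (p_core p Q) Y" using p_core_char[OF R_normal] by simp
  have "p_core p Q \<subseteq> {\<one>}"
    by (rule edge_transitive_faithful[OF normal_in_refl[OF X] normal_in_refl[OF Y] TX_whole TY_whole])
      (use normal_inD(3,6)[OF QX] normal_inD(3,6)[OF QY] in auto)
  then show False using assms subgroup.one_closed[OF normal_inD(1)[OF QX]] by blast
qed

text \<open>O_p(Q) and O_q(R) are normal in \<open>X \<inter> Y\<close> and meet trivially, so they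
  commute. The centraliser of O_q(R) in \<open>Y\<close> thus contains O_p(Q), which lies in
  \<open>X\<close> but not in \<open>R\<close>.\<close>

lemma centralizer_p_core_transitive:
  assumes p: "prime p" "prime q" "p \<noteq> q" and nt: "p_core p Q \<noteq> {\<one>}"
  shows "normal_in (centralizer Y (p_core q R)) Y" "TY (centralizer Y (p_core q R))"
proof -
  have R': "normal_in (p_core q R) Y" by (rule p_core_char[OF R_normal])
  show n: "normal_in (centralizer Y (p_core q R)) Y"
    by (rule centralizer_normal_in[OF Y normal_inD(4,6)[OF R']])
  have RB: "normal_in R (X \<inter> Y)"
    using semiprimitive_amalgam.kernel_normal_in_arc[OF swap] by (simp add: Int_commute)
  have "a \<otimes> b = b \<otimes> a" if "a \<in> p_core p Q" "b \<in> p_core q R" for a b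
    by (rule normal_in_commute[OF p_core_char[OF kernel_normal_in_arc] p_core_char[OF RB]
          p_core_disjoint[OF Q p] that])
  then have "p_core p Q \<subseteq> centralizer Y (p_core q R) \<inter> X"
    using normal_inD(3)[OF p_core_char[OF kernel_normal_in_arc]] unfolding centralizer_def by blast
  then show "TY (centralizer Y (p_core q R))"
    using p_core_not_le[OF nt] by (intro semiprimitive_Y[OF n]) blast
qed

text \<open>The q-core of \<open>Q \<inter> R\<close> lies in both O_q(Q) and O_q(R), so it is fixed
  elementwise by locally transitive normal subgroups at both ends.\<close>

lemma p_core_arc_kernel_trivial:
  assumes p: "prime p" "prime q" "p \<noteq> q" and nt: "p_core p Q \<noteq> {\<one>}"
  shows "p_core q (Q \<inter> R) \<subseteq> {\<one>}"
proof (rule edge_transitive_faithful)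
  show "normal_in (centralizer Y (p_core q R)) Y" "TY (centralizer Y (p_core q R))"
    by (rule centralizer_p_core_transitive[OF p nt])+
  show "normal_in (centralizer X (p_core q Q)) X" "TX (centralizer X (p_core q Q))"
    by (rule semiprimitive_amalgam.centralizer_p_core_transitive[OF swap p p_core_swap_trivial[OF nt]])+
  show "p_core q (Q \<inter> R) \<subseteq> X \<inter> Y"
    by (rule normal_inD(3)[OF p_core_char[OF arc_kernel_normal_in]])
  have le: "p_core q (Q \<inter> R) \<subseteq> p_core q Q" "p_core q (Q \<inter> R) \<subseteq> p_core q R"
    using p_core_mono[OF arc_kernel_normal_in_kernel]
      p_core_mono[OF semiprimitive_amalgam.arc_kernel_normal_in_kernel[OF swap]]
    by (simp_all add: Int_commute)
  have c: "p_core q Q \<subseteq> carrier G" "p_core q R \<subseteq> carrier G"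
    by (rule normal_inD(4)[OF p_core_normal_in[OF Q]], rule normal_inD(4)[OF p_core_normal_in[OF R]])
  fix g s assume "g \<in> centralizer X (p_core q Q) \<union> centralizer Y (p_core q R)" "s \<in> p_core q (Q \<inter> R)"
  then have "conj_by g s = s"
    using conj_by_centralizer_eq[OF c(1) normal_inD(5)[OF Q_normal], of g s]
      conj_by_centralizer_eq[OF c(2) normal_inD(5)[OF R_normal], of g s] le by blast
  then show "conj_by g s \<in> p_core q (Q \<inter> R)" using \<open>s \<in> _\<close> by simp
qed

lemma exists_characteristic_prime:
  assumes K: "Q \<inter> R \<noteq> {\<one>}"
  shows "\<exists>p. prime p \<and> p_core p Q \<noteq> {\<one>} \<and> (\<forall>q. prime q \<longrightarrow> q \<noteq> p \<longrightarrow> p_core q (X \<inter> Y) \<subseteq> {\<one>})"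
proof -
  have nq: "False" if "normal_in H (X \<inter> Y)" "subnormal (G\<lparr>carrier := H\<rparr>) L" "quasisimple_in L" for H L
    using no_component[OF K subnormal_in_normal[OF that(1,2)] that(3)] .
  have K1: "\<one> \<in> Q \<inter> R" using subgroup.one_closed[OF Q] subgroup.one_closed[OF R] by simp
  then have Q1: "Q \<noteq> {\<one>}" using K by blast
  have "\<exists>p. prime p \<and> p_core p Q \<noteq> {\<one>}"
    by (rule nontrivial_p_core[OF fin Q Q1 nq[OF kernel_normal_in_arc]])
  then obtain p where p: "prime p" "p_core p Q \<noteq> {\<one>}" by blast
  have "p_core q (X \<inter> Y) \<subseteq> {\<one>}" if q: "prime q" "q \<noteq> p" for q
  proof -
    have "p_core q Q = {\<one>}"
    proof (rule ccontr)
      assume nt: "p_core q Q \<noteq> {\<one>}"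
      \<comment> \<open>Every prime \<open>s\<close> differs from \<open>p\<close> or from
        \<open>q\<close>. So all p-cores of \<open>Q \<inter> R\<close> would vanish, against
        \<open>nontrivial_p_core\<close>.\<close>
      have "p_core s (Q \<inter> R) \<subseteq> {\<one>}" if "prime s" for s
        using p_core_arc_kernel_trivial[OF p(1) that _ p(2)] p_core_arc_kernel_trivial[OF q(1) that _ nt] q(2)
        by blast
      moreover have "\<exists>s. prime s \<and> p_core s (Q \<inter> R) \<noteq> {\<one>}"
        by (rule nontrivial_p_core[OF fin normal_inD(1)[OF arc_kernel_normal_in] K
              nq[OF arc_kernel_normal_in]])
      moreover have "\<one> \<in> p_core s (Q \<inter> R)" for s
        by (rule subgroup.one_closed[OF normal_inD(1)[OF p_core_char[OF arc_kernel_normal_in]]])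
      ultimately show False by blast
    qed
    \<comment> \<open>The q-core of \<open>X \<inter> Y\<close> now meets \<open>Q\<close>
      trivially, so it centralises \<open>Q\<close>. By \<open>centralizer_kernel\<close> it lies in
      \<open>Q\<close>, and is therefore trivial.\<close>
    then have I: "p_core q (X \<inter> Y) \<inter> Q \<subseteq> {\<one>}"
      using p_core_Int[OF arc_subgroup Q normal_inD(3)[OF kernel_normal_in_arc], of q] by simp
    have B': "normal_in (p_core q (X \<inter> Y)) (X \<inter> Y)" by (rule p_core_normal_in[OF arc_subgroup])
    have "a \<otimes> b = b \<otimes> a" if "a \<in> p_core q (X \<inter> Y)" "b \<in> Q" for a b
      by (rule normal_in_commute[OF B' kernel_normal_in_arc I that])
    then have "p_core q (X \<inter> Y) \<subseteq> centralizer (X \<inter> Y) Q"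
      using normal_inD(3)[OF B'] unfolding centralizer_def by blast
    then show ?thesis using centralizer_kernel[OF K] I by blast
  qed
  then show ?thesis using p by blast
qed

section \<open>The arc kernel consists of p-elements\<close>

definition coprime_elements :: "nat \<Rightarrow> 'a set" where
  "coprime_elements p = {k \<in> Q \<inter> R. \<exists>m. coprime m p \<and> k [^] m = \<one>}"

text \<open>Ranging over all conjugates under \<open>Y\<close> makes this the kernel of an action of
  \<open>Y\<close> on those conjugates, hence normal in \<open>Y\<close>; the stabiliser of the
  single set \<open>coprime_elements p\<close> need not be.\<close>

definition Y_normalizer :: "nat \<Rightarrow> 'a set" where
  "Y_normalizer p = {g \<in> Y. \<forall>h\<in>Y. conj_by g ` conj_by h ` coprime_elements p = conj_by h ` coprime_elements p}"

lemma Y_normalizer_normal_in: "normal_in (Y_normalizer p) Y"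
proof -
  let ?S = "coprime_elements p"
  have Yc: "y \<in> carrier G" if "y \<in> Y" for y using that normal_inD(5)[OF R_normal] by blast
  have Sc: "?S \<subseteq> carrier G" using normal_inD(4)[OF Q_normal] by (auto simp: coprime_elements_def)
  have hS: "conj_by h ` ?S \<subseteq> carrier G" if "h \<in> Y" for h using Sc Yc[OF that] by blast
  note m = subgroup.m_closed[OF Y] and i = subgroup.m_inv_closed[OF Y]
  have D: "g \<in> Y" "g \<in> carrier G" "h \<in> Y \<Longrightarrow> conj_by g ` conj_by h ` ?S = conj_by h ` ?S"
    if "g \<in> Y_normalizer p" for g h
    using that Yc unfolding Y_normalizer_def by auto
  show ?thesis
  proof (rule normal_inI)
    show "subgroup (Y_normalizer p) G"
    proof (rule subgroupI)
      show "Y_normalizer p \<subseteq> carrier G" using D(2) by blast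
      have "conj_by \<one> ` conj_by h ` ?S = conj_by h ` ?S" if "h \<in> Y" for h
        using hS[OF that] by (simp add: image_cong[of _ _ "conj_by \<one>" "\<lambda>x. x"] subset_iff)
      then have "\<one> \<in> Y_normalizer p" using subgroup.one_closed[OF Y] by (simp add: Y_normalizer_def)
      then show "Y_normalizer p \<noteq> {}" by blast
    next
      fix g assume g: "g \<in> Y_normalizer p"
      have "conj_by (inv g) ` conj_by h ` ?S = conj_by h ` ?S" if h: "h \<in> Y" for h
        using conj_by_image_inv_cancel(1)[OF D(2)[OF g] hS[OF h]] D(3)[OF g h] by simp
      then show "inv g \<in> Y_normalizer p" using i[OF D(1)[OF g]] by (simp add: Y_normalizer_def)
    next
      fix g g' assume g: "g \<in> Y_normalizer p" "g' \<in> Y_normalizer p"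
      have "conj_by (g \<otimes> g') ` conj_by h ` ?S = conj_by h ` ?S" if h: "h \<in> Y" for h
        using conj_by_image_comp[OF D(2)[OF g(1)] D(2)[OF g(2)] hS[OF h]] D(3)[OF g(1) h] D(3)[OF g(2) h]
        by simp
      then show "g \<otimes> g' \<in> Y_normalizer p"
        using m[OF D(1)[OF g(1)] D(1)[OF g(2)]] by (simp add: Y_normalizer_def)
    qed
    fix k g assume k: "k \<in> Y" and g: "g \<in> Y_normalizer p"
    have kY: "inv k \<in> Y" by (rule i[OF k])
    have "conj_by (conj_by k g) ` conj_by h ` ?S = conj_by h ` ?S" if h: "h \<in> Y" for h
    proof -
      have kh: "inv k \<otimes> h \<in> Y" by (rule m[OF kY h])
      have "conj_by (conj_by k g) ` conj_by h ` ?S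
          = conj_by k ` conj_by g ` conj_by (inv k) ` conj_by h ` ?S"
        unfolding conj_by_def[of k g] using Yc[OF k] Yc[OF kY] D(2)[OF g] hS[OF h] m[OF kY h]
        by (subst conj_by_image_comp, simp_all, subst conj_by_image_comp) auto
      also have "conj_by (inv k) ` conj_by h ` ?S = conj_by (inv k \<otimes> h) ` ?S"
        using conj_by_image_comp[OF Yc[OF kY] Yc[OF h] Sc] by simp
      also have "conj_by g ` conj_by (inv k \<otimes> h) ` ?S = conj_by (inv k \<otimes> h) ` ?S" by (rule D(3)[OF g kh])
      also have "conj_by k ` conj_by (inv k \<otimes> h) ` ?S = conj_by h ` ?S"
        using conj_by_image_comp[OF Yc[OF k] Yc[OF kh] Sc] Yc[OF k] Yc[OF h]
        by (simp add: inv_mult_cancel_left)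
      finally show ?thesis .
    qed
    then show "conj_by k g \<in> Y_normalizer p"
      using conj_by_mem[OF Y k D(1)[OF g]] by (simp add: Y_normalizer_def)
  qed (use Y D(1) in auto)
qed

text \<open>\<open>Q \<inter> R\<close> is normal in \<open>R\<close>, and \<open>R\<close> is
  normal in \<open>Y\<close>; so every conjugate of \<open>Q \<inter> R\<close> under
  \<open>Y\<close> is normal in \<open>R\<close>, which is normal in \<open>X \<inter> Y\<close>.
  Since O_p(Q) is normal in \<open>X \<inter> Y\<close> too,
  \<open>normal_p_subgroup_conj_coprime_order\<close> applies to each conjugate.\<close>

lemma p_core_le_Y_normalizer: "p_core p Q \<subseteq> Y_normalizer p"
proof
  let ?S = "coprime_elements p" and ?P = "p_core p Q"
  have Yc: "y \<in> carrier G" if "y \<in> Y" for y using that normal_inD(5)[OF R_normal] by blast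
  have KR: "normal_in (Q \<inter> R) R"
    using semiprimitive_amalgam.arc_kernel_normal_in_kernel[OF swap] by (simp add: Int_commute)
  have RB: "normal_in R (X \<inter> Y)"
    using semiprimitive_amalgam.kernel_normal_in_arc[OF swap] by (simp add: Int_commute)
  have PB: "normal_in ?P (X \<inter> Y)" by (rule p_core_char[OF kernel_normal_in_arc])
  note P' = normal_inD[OF PB]
  have sub: "conj_by g ` conj_by h ` ?S \<subseteq> conj_by h ` ?S" if g: "g \<in> ?P" and h: "h \<in> Y" for g h
  proof
    fix a assume "a \<in> conj_by g ` conj_by h ` ?S"
    then obtain s m where s: "a = conj_by g (conj_by h s)" "s \<in> Q \<inter> R" "coprime m p" "s [^] m = \<one>"
      by (auto simp: coprime_elements_def)
    have hc: "h \<in> carrier G" and gc: "g \<in> carrier G" and sc: "s \<in> carrier G"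
      using Yc[OF h] P'(4) g s(2) normal_inD(4)[OF Q_normal] by auto
    have N: "normal_in (conj_by h ` (Q \<inter> R)) R"
      using normal_in_conj_by[OF KR hc] normal_in_conj_image[OF R_normal h] by simp
    have pow: "conj_by h s [^] m = \<one>" using s(4) hc sc by (simp flip: conj_by_nat_pow)
    have "a \<in> conj_by h ` (Q \<inter> R)"
      unfolding s(1)
      by (rule normal_p_subgroup_conj_coprime_order[OF N RB PB p_core_p_element g imageI[OF s(2)] pow s(3)])
    then obtain k where k: "k \<in> Q \<inter> R" "a = conj_by h k" by blast
    have kc: "k \<in> carrier G" using k(1) normal_inD(4)[OF Q_normal] by blast
    have "conj_by h (k [^] m) = a [^] m" using k(2) conj_by_nat_pow[OF hc kc] by simp
    also have "\<dots> = \<one>" using s(1,4) hc gc sc by (simp flip: conj_by_nat_pow)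
    finally have "k [^] m = \<one>" using hc kc by simp
    then show "a \<in> conj_by h ` ?S" using k s(3) by (auto simp: coprime_elements_def)
  qed
  fix g assume g: "g \<in> ?P"
  have gc: "g \<in> carrier G" and gY: "g \<in> Y" using P'(3,4) g by auto
  have "conj_by g ` conj_by h ` ?S = conj_by h ` ?S" if h: "h \<in> Y" for h
  proof
    show "conj_by g ` conj_by h ` ?S \<subseteq> conj_by h ` ?S" by (rule sub[OF g h])
    have hS: "conj_by h ` ?S \<subseteq> carrier G"
      using Yc[OF h] normal_inD(4)[OF Q_normal] by (auto simp: coprime_elements_def)
    have "conj_by (inv g) ` conj_by h ` ?S \<subseteq> conj_by h ` ?S"
      by (rule sub[OF subgroup.m_inv_closed[OF P'(1) g] h])
    from image_mono[OF this, of "conj_by g"]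
    show "conj_by h ` ?S \<subseteq> conj_by g ` conj_by h ` ?S"
      using conj_by_image_inv_cancel(2)[OF gc hS] by simp
  qed
  then show "g \<in> Y_normalizer p" using gY by (simp add: Y_normalizer_def)
qed

lemma Y_normalizer_transitive:
  assumes "p_core p Q \<noteq> {\<one>}"
  shows "TY (Y_normalizer p)"
  using p_core_not_le[OF assms] p_core_le_Y_normalizer[of p]
    normal_inD(3)[OF p_core_char[OF Q_normal, of p]]
  by (intro semiprimitive_Y[OF Y_normalizer_normal_in]) blast

lemma Y_normalizer_conj_by:
  assumes "g \<in> Y_normalizer p" "s \<in> coprime_elements p"
  shows "conj_by g s \<in> coprime_elements p"
proof -
  have "conj_by \<one> ` coprime_elements p = coprime_elements p"
    using normal_inD(4)[OF Q_normal] by (auto simp: coprime_elements_def subset_iff image_iff)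
  then have "conj_by g ` coprime_elements p = coprime_elements p"
    using assms(1) subgroup.one_closed[OF Y] unfolding Y_normalizer_def by force
  then show ?thesis using assms(2) by blast
qed

lemma arc_kernel_p_element:
  assumes p: "prime p" and nt: "p_core p Q \<noteq> {\<one>}" and k: "k \<in> Q \<inter> R"
  shows "p_element p k"
proof -
  interpret S: semiprimitive_amalgam G Y X R Q t TY TX by (rule swap)
  \<comment> \<open>The set \<open>coprime_elements p\<close> is the same seen from either end of
    the arc, so locally transitive normal subgroups at both ends preserve it.\<close>
  have eq: "S.coprime_elements p = coprime_elements p"
    by (simp add: coprime_elements_def S.coprime_elements_def Int_commute)
  have triv: "coprime_elements p \<subseteq> {\<one>}"
  proof (rule edge_transitive_faithful)
    show "normal_in (S.Y_normalizer p) X" "TX (S.Y_normalizer p)"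
      by (rule S.Y_normalizer_normal_in, rule S.Y_normalizer_transitive[OF p_core_swap_trivial[OF nt]])
    show "normal_in (Y_normalizer p) Y" "TY (Y_normalizer p)"
      by (rule Y_normalizer_normal_in, rule Y_normalizer_transitive[OF nt])
    show "coprime_elements p \<subseteq> X \<inter> Y"
      using normal_inD(3)[OF arc_kernel_normal_in] by (auto simp: coprime_elements_def)
    fix g s assume "g \<in> S.Y_normalizer p \<union> Y_normalizer p" "s \<in> coprime_elements p"
    then show "conj_by g s \<in> coprime_elements p"
      using Y_normalizer_conj_by[of g p s] S.Y_normalizer_conj_by[of g p s] by (auto simp: eq)
  qed
  show ?thesis
  proof (rule p_element_if_no_other_prime_order[OF fin normal_inD(1)[OF arc_kernel_normal_in] p k])
    fix q u assume q: "prime q" "q \<noteq> p" and u: "u \<in> Q \<inter> R" "u [^] q = \<one>"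
    have "coprime q p" using q p by (simp add: primes_coprime)
    then have "u \<in> coprime_elements p" using u by (auto simp: coprime_elements_def)
    then show "u = \<one>" using triv by blast
  qed
qed

theorem arc_kernel_cases:
  "\<exists>p. prime p \<and> p_group p (G\<lparr>carrier := Q \<inter> R\<rparr>) \<and>
    (p_group p (G\<lparr>carrier := generalised_fitting_subgroup (G\<lparr>carrier := X \<inter> Y\<rparr>)\<rparr>) \<or> Q \<inter> R = {\<one>})"
proof (cases "Q \<inter> R = {\<one>}")
  case True
  \<comment> \<open>The trivial group is a p-group for every prime; \<open>2\<close> is an arbitrary
    choice.\<close>
  have "p_group 2 (G\<lparr>carrier := Q \<inter> R\<rparr>)"
    by (rule p_group_if_p_elements[OF fin normal_inD(1)[OF arc_kernel_normal_in]])
      (use True in \<open>auto simp: two_is_prime_nat\<close>)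
  then show ?thesis using True two_is_prime_nat by blast
next
  case False
  obtain p where p: "prime p" "p_core p Q \<noteq> {\<one>}"
    "\<And>q. prime q \<Longrightarrow> q \<noteq> p \<Longrightarrow> p_core q (X \<inter> Y) \<subseteq> {\<one>}"
    using exists_characteristic_prime[OF False] by blast
  have "p_group p (G\<lparr>carrier := Q \<inter> R\<rparr>)"
    by (rule p_group_if_p_elements[OF fin normal_inD(1)[OF arc_kernel_normal_in] p(1)
          arc_kernel_p_element[OF p(1,2)]])
  moreover have "p_group p (G\<lparr>carrier := generalised_fitting_subgroup (G\<lparr>carrier := X \<inter> Y\<rparr>)\<rparr>)"
    by (rule p_group_generalised_fitting[OF fin p(1) arc_subgroup p(3) no_component[OF False]])
  ultimately show ?thesis using p(1) by blast
qed

end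

section \<open>Action on the graph\<close>

lemma BijGroup_simps:
  "carrier (BijGroup S) = Bij S"
  "\<lbrakk>g \<in> Bij S; h \<in> Bij S; v \<in> S\<rbrakk> \<Longrightarrow> (g \<otimes>\<^bsub>BijGroup S\<^esub> h) v = g (h v)"
  "v \<in> S \<Longrightarrow> \<one>\<^bsub>BijGroup S\<^esub> v = v"
  by (simp_all add: BijGroup_def compose_def)

lemma Bij_mem: "\<lbrakk>g \<in> Bij S; v \<in> S\<rbrakk> \<Longrightarrow> g v \<in> S"
  using Bij_imp_funcset by blast

lemma BijGroup_inv:
  assumes "g \<in> Bij S"
  shows "inv\<^bsub>BijGroup S\<^esub> g \<in> Bij S"
    "v \<in> S \<Longrightarrow> g ((inv\<^bsub>BijGroup S\<^esub> g) v) = v"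
    "v \<in> S \<Longrightarrow> (inv\<^bsub>BijGroup S\<^esub> g) (g v) = v"
proof -
  interpret B: group "BijGroup S" by (rule group_BijGroup)
  show i: "inv\<^bsub>BijGroup S\<^esub> g \<in> Bij S"
    using B.inv_closed[of g] assms by (simp add: BijGroup_simps)
  assume v: "v \<in> S"
  have g: "g \<in> carrier (BijGroup S)" using assms by (simp add: BijGroup_simps)
  show "g ((inv\<^bsub>BijGroup S\<^esub> g) v) = v" "(inv\<^bsub>BijGroup S\<^esub> g) (g v) = v"
    using BijGroup_simps(2)[OF assms i v] BijGroup_simps(2)[OF i assms v] B.r_inv[OF g] B.l_inv[OF g]
      BijGroup_simps(3)[OF v] by simp_all
qed

lemma Bij_eqI:
  assumes "g \<in> Bij S" "h \<in> Bij S" "\<And>v. v \<in> S \<Longrightarrow> g v = h v"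
  shows "g = h"
  using extensionalityI[OF Bij_imp_extensional Bij_imp_extensional] assms by blast

lemma finite_Bij: "finite S \<Longrightarrow> finite (Bij S)"
  by (rule finite_subset[OF _ finite_PiE[of S "\<lambda>_. S"]])
    (auto simp: PiE_def Bij_imp_extensional Bij_mem)

lemma subgroup_graph_auto:
  "subgroup (graph_auto D) (BijGroup (pverts D))"
proof (rule group.subgroupI[OF group_BijGroup])
  let ?V = "pverts D"
  show "graph_auto D \<subseteq> carrier (BijGroup ?V)" by (auto simp: graph_auto_def BijGroup_simps)
  have "\<one>\<^bsub>BijGroup ?V\<^esub> \<in> graph_auto D"
    using monoid.one_closed[OF group.is_monoid[OF group_BijGroup], of ?V]
    by (simp add: graph_auto_def BijGroup_simps)
  then show "graph_auto D \<noteq> {}" by blast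
  fix g assume g: "g \<in> graph_auto D"
  then have gB: "g \<in> Bij ?V" by (simp add: graph_auto_def)
  have "((inv\<^bsub>BijGroup ?V\<^esub> g) u, (inv\<^bsub>BijGroup ?V\<^esub> g) v) \<in> parcs D \<longleftrightarrow> (u, v) \<in> parcs D"
    if uv: "u \<in> ?V" "v \<in> ?V" for u v
  proof -
    have "(g ((inv\<^bsub>BijGroup ?V\<^esub> g) u), g ((inv\<^bsub>BijGroup ?V\<^esub> g) v)) \<in> parcs D
        \<longleftrightarrow> ((inv\<^bsub>BijGroup ?V\<^esub> g) u, (inv\<^bsub>BijGroup ?V\<^esub> g) v) \<in> parcs D"
      using g uv Bij_mem[OF BijGroup_inv(1)[OF gB]] by (auto simp: graph_auto_def)
    then show ?thesis using BijGroup_inv(2)[OF gB] uv by simp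
  qed
  then show "inv\<^bsub>BijGroup ?V\<^esub> g \<in> graph_auto D"
    using BijGroup_inv(1)[OF gB] by (simp add: graph_auto_def)
  fix h assume h: "h \<in> graph_auto D"
  then have hB: "h \<in> Bij ?V" by (simp add: graph_auto_def)
  have "g \<otimes>\<^bsub>BijGroup ?V\<^esub> h \<in> Bij ?V"
    using monoid.m_closed[OF group.is_monoid[OF group_BijGroup], of g ?V h] gB hB by (simp add: BijGroup_simps)
  then show "g \<otimes>\<^bsub>BijGroup ?V\<^esub> h \<in> graph_auto D"
    using g h gB hB by (auto simp: graph_auto_def BijGroup_simps Bij_mem)
qed

section \<open>The group acting on vertices and arcs\<close>

locale graph_automorphism_group =
  fixes D :: "'a pair_pre_digraph" and G :: "('a \<Rightarrow> 'a) set"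
  assumes graph: "pair_graph D" and conn: "Digraph_Component.connected (with_proj D)"
    and G_Aut: "subgroup G (graph_AutoGroup D)"
begin

abbreviation A :: "('a \<Rightarrow> 'a) monoid" where
  "A \<equiv> perm_group (pverts D) G"

lemma G_sub: "subgroup G (BijGroup (pverts D))"
  using group.incl_subgroup[OF group_BijGroup subgroup_graph_auto] G_Aut
  by (simp add: graph_AutoGroup_def)

sublocale A: group A
  by (rule group.subgroup_imp_group[OF group_BijGroup G_sub])

lemma G_Bij: "g \<in> G \<Longrightarrow> g \<in> Bij (pverts D)"
  using subgroup.subset[OF G_sub] by (auto simp: BijGroup_simps)

lemma G_mem [simp]: "g \<in> G \<Longrightarrow> v \<in> pverts D \<Longrightarrow> g v \<in> pverts D"
  by (rule Bij_mem[OF G_Bij])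

lemma G_mult [simp]:
  "\<lbrakk>g \<in> G; h \<in> G; v \<in> pverts D\<rbrakk> \<Longrightarrow> (g \<otimes>\<^bsub>A\<^esub> h) v = g (h v)"
  by (simp add: BijGroup_simps G_Bij)

lemma G_one [simp]: "v \<in> pverts D \<Longrightarrow> \<one>\<^bsub>A\<^esub> v = v"
  by (simp add: BijGroup_simps)

lemma G_inv [simp]:
  assumes "g \<in> G" "v \<in> pverts D"
  shows "g ((inv\<^bsub>A\<^esub> g) v) = v" "(inv\<^bsub>A\<^esub> g) (g v) = v"
  using BijGroup_inv[OF G_Bij[OF assms(1)]] assms
  by (simp_all add: group.m_inv_consistent[OF group_BijGroup G_sub])

lemma G_conj_by [simp]:
  assumes "g \<in> G" "h \<in> G" "v \<in> pverts D"
  shows "(A.conj_by g h) (g v) = g (h v)"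
  using assms A.inv_closed[of g] A.m_closed[of g h]
    G_mult[of "g \<otimes>\<^bsub>A\<^esub> h" "inv\<^bsub>A\<^esub> g" "g v"] G_mult[of g h v] G_inv(2)[of g v]
  by (simp add: A.conj_by_def)

lemma G_eqI:
  assumes "g \<in> G" "h \<in> G" "\<And>v. v \<in> pverts D \<Longrightarrow> g v = h v"
  shows "g = h"
  using assms by (intro Bij_eqI[of g "pverts D" h]) (auto simp: G_Bij)

lemma finite_G: "finite G"
proof -
  interpret pair_graph D by (rule graph)
  have "finite (Bij (pverts D))" by (rule finite_Bij) simp
  then show ?thesis by (rule finite_subset[rotated]) (auto simp: G_Bij)
qed

lemma arc_verts:
  assumes "(u, v) \<in> parcs D"
  shows "u \<in> pverts D" "v \<in> pverts D"
proof -
  interpret pair_graph D by (rule graph)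
  show "u \<in> pverts D" "v \<in> pverts D" using in_arcsD1 in_arcsD2 assms by blast+
qed

lemma arc_sym: "(u, v) \<in> parcs D \<Longrightarrow> (v, u) \<in> parcs D"
proof -
  interpret pair_graph D by (rule graph)
  assume "(u, v) \<in> parcs D"
  then show ?thesis using pair_sym_arcs by (auto simp: symmetric_def elim: symE)
qed

lemma arc_image:
  assumes "g \<in> G" "(u, v) \<in> parcs D"
  shows "(g u, g v) \<in> parcs D"
proof -
  have "g \<in> graph_auto D" using assms(1) subgroup.subset[OF G_Aut] by (auto simp: graph_AutoGroup_def)
  then show ?thesis using assms(2) arc_verts[OF assms(2)] by (auto simp: graph_auto_def)
qed

lemma neighbours_iff [simp]: "w \<in> neighbours D z \<longleftrightarrow> (z, w) \<in> parcs D"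
  by (simp add: neighbours_def)

lemma connected_induct:
  assumes x: "x \<in> pverts D" and "v \<in> pverts D" and "P x"
    and step: "\<And>u w. \<lbrakk>P u; (u, w) \<in> parcs D\<rbrakk> \<Longrightarrow> P w"
  shows "P v"
proof -
  interpret pair_graph D by (rule graph)
  \<comment> \<open>Connectedness is defined through the symmetric closure. The arc set is already
    symmetric, so reachability there is reachability in \<open>D\<close>.\<close>
  have "x \<rightarrow>\<^sup>*\<^bsub>mk_symmetric (with_proj D)\<^esub> v"
    using conn assms(1,2) by (simp add: connected_def strongly_connected_def)
  then have "x \<rightarrow>\<^sup>*\<^bsub>with_proj D\<^esub> v"
    using reachable_mk_symmetric_eq[OF pair_sym_arcs] by simp
  then show ?thesis
    by (induction rule: reachable_induct) (use assms in auto)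
qed

section \<open>Vertex stabilisers and kernels under conjugation\<close>

lemma stabilizer_iff: "g \<in> vertex_stabilizer D G z \<longleftrightarrow> g \<in> G \<and> g z = z"
  by (simp add: vertex_stabilizer_def stabilizer_def)

lemma kernel_iff:
  "g \<in> vertex_kernel D G z \<longleftrightarrow> g \<in> G \<and> g z = z \<and> (\<forall>w. (z, w) \<in> parcs D \<longrightarrow> g w = w)"
  by (auto simp: vertex_kernel_def stabilizer_iff)

lemma inv_fixes: "\<lbrakk>g \<in> G; v \<in> pverts D; g v = v\<rbrakk> \<Longrightarrow> (inv\<^bsub>A\<^esub> g) v = v"
  by (metis G_inv(2))

lemma subgroup_stabilizer:
  assumes "z \<in> pverts D"
  shows "subgroup (vertex_stabilizer D G z) A"
proof (rule A.subgroupI)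
  have "\<one>\<^bsub>A\<^esub> \<in> vertex_stabilizer D G z"
    using A.one_closed G_one[OF assms] unfolding stabilizer_iff by simp
  then show "vertex_stabilizer D G z \<noteq> {}" by blast
  show "vertex_stabilizer D G z \<subseteq> carrier A" by (auto simp: stabilizer_iff)
  fix g assume g: "g \<in> vertex_stabilizer D G z"
  show "inv\<^bsub>A\<^esub> g \<in> vertex_stabilizer D G z"
    using g A.inv_closed[of g] inv_fixes[of g z] assms unfolding stabilizer_iff by simp
  fix h assume h: "h \<in> vertex_stabilizer D G z"
  show "g \<otimes>\<^bsub>A\<^esub> h \<in> vertex_stabilizer D G z"
    using g h A.m_closed[of g h] G_mult[of g h z] assms unfolding stabilizer_iff by simp
qed

lemma subgroup_kernel:
  assumes "z \<in> pverts D"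
  shows "subgroup (vertex_kernel D G z) A"
proof -
  have eq: "vertex_kernel D G z = vertex_stabilizer D G z \<inter> {g. \<forall>w. (z, w) \<in> parcs D \<longrightarrow> g w = w}"
    by (auto simp: kernel_iff stabilizer_iff)
  note S = subgroup_stabilizer[OF assms]
  show ?thesis
  proof (rule A.subgroupI)
    have "\<one>\<^bsub>A\<^esub> \<in> vertex_kernel D G z"
      using subgroup.one_closed[OF S] G_one arc_verts(2) unfolding eq by auto
    then show "vertex_kernel D G z \<noteq> {}" by blast
    show "vertex_kernel D G z \<subseteq> carrier A" by (auto simp: kernel_iff)
    fix g assume g: "g \<in> vertex_kernel D G z"
    show "inv\<^bsub>A\<^esub> g \<in> vertex_kernel D G z"
      using g subgroup.m_inv_closed[OF S, of g] inv_fixes[of g] arc_verts(2)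
      unfolding eq by (auto simp: stabilizer_iff)
    fix h assume h: "h \<in> vertex_kernel D G z"
    show "g \<otimes>\<^bsub>A\<^esub> h \<in> vertex_kernel D G z"
      using g h subgroup.m_closed[OF S, of g h] G_mult[of g h] arc_verts(2)
      unfolding eq by (auto simp: stabilizer_iff)
  qed
qed

lemma conj_by_stabilizer_sub:
  assumes g: "g \<in> G" and z: "z \<in> pverts D"
  shows "A.conj_by g ` vertex_stabilizer D G z \<subseteq> vertex_stabilizer D G (g z)"
proof
  fix a assume "a \<in> A.conj_by g ` vertex_stabilizer D G z"
  then obtain h where h: "h \<in> G" "h z = z" "a = A.conj_by g h" by (auto simp: stabilizer_iff)
  then show "a \<in> vertex_stabilizer D G (g z)"
    using G_conj_by[OF g h(1) z] A.conj_by_closed[of g h] g by (simp add: stabilizer_iff)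
qed

lemma conj_by_kernel_sub:
  assumes g: "g \<in> G" and z: "z \<in> pverts D"
  shows "A.conj_by g ` vertex_kernel D G z \<subseteq> vertex_kernel D G (g z)"
proof
  fix a assume "a \<in> A.conj_by g ` vertex_kernel D G z"
  then obtain h where h: "h \<in> G" "h z = z" "\<And>w. (z, w) \<in> parcs D \<Longrightarrow> h w = w" "a = A.conj_by g h"
    by (auto simp: kernel_iff)
  have ig: "inv\<^bsub>A\<^esub> g \<in> G" using A.inv_closed[of g] g by simp
  have "a w = w" if w: "(g z, w) \<in> parcs D" for w
  proof -
    have "(z, (inv\<^bsub>A\<^esub> g) w) \<in> parcs D"
      using arc_image[OF ig w] G_inv(2)[OF g z] by simp
    then have "h ((inv\<^bsub>A\<^esub> g) w) = (inv\<^bsub>A\<^esub> g) w" by (rule h(3))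
    then show ?thesis
      using G_conj_by[OF g h(1) G_mem[OF ig arc_verts(2)[OF w]]] G_inv(1)[OF g arc_verts(2)[OF w]] h(4)
      by simp
  qed
  then show "a \<in> vertex_kernel D G (g z)"
    using G_conj_by[OF g h(1) z] A.conj_by_closed[of g h] g h by (simp add: kernel_iff)
qed

text \<open>The inclusion for the inverse of \<open>g\<close> at the vertex \<open>g z\<close>
  supplies the reverse inclusion. Used with \<open>F\<close> the stabiliser and with
  \<open>F\<close> the kernel.\<close>

lemma conj_by_image_eqI:
  assumes sub: "\<And>g z. \<lbrakk>g \<in> G; z \<in> pverts D\<rbrakk> \<Longrightarrow> A.conj_by g ` F z \<subseteq> F (g z)"
    and F: "\<And>z. F z \<subseteq> G" and g: "g \<in> G" and z: "z \<in> pverts D"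
  shows "A.conj_by g ` F z = F (g z)"
proof
  have ig: "inv\<^bsub>A\<^esub> g \<in> G" using A.inv_closed[of g] g by simp
  have "A.conj_by (inv\<^bsub>A\<^esub> g) ` F (g z) \<subseteq> F z"
    using sub[OF ig G_mem[OF g z]] G_inv(2)[OF g z] by simp
  from image_mono[OF this, of "A.conj_by g"] show "F (g z) \<subseteq> A.conj_by g ` F z"
    using A.conj_by_image_inv_cancel(2)[of g "F (g z)"] F g by simp
qed (rule sub[OF g z])

lemma conj_by_stabilizer:
  "\<lbrakk>g \<in> G; z \<in> pverts D\<rbrakk> \<Longrightarrow> A.conj_by g ` vertex_stabilizer D G z = vertex_stabilizer D G (g z)"
  by (rule conj_by_image_eqI[OF conj_by_stabilizer_sub]) (auto simp: stabilizer_iff)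

lemma conj_by_kernel:
  "\<lbrakk>g \<in> G; z \<in> pverts D\<rbrakk> \<Longrightarrow> A.conj_by g ` vertex_kernel D G z = vertex_kernel D G (g z)"
  by (rule conj_by_image_eqI[OF conj_by_kernel_sub]) (auto simp: kernel_iff)

lemma kernel_normal_in_stabilizer:
  assumes z: "z \<in> pverts D"
  shows "A.normal_in (vertex_kernel D G z) (vertex_stabilizer D G z)"
proof (rule A.normal_inI[OF subgroup_kernel[OF z] subgroup_stabilizer[OF z]])
  show "vertex_kernel D G z \<subseteq> vertex_stabilizer D G z" by (auto simp: kernel_iff stabilizer_iff)
  fix k h assume k: "k \<in> vertex_stabilizer D G z" and h: "h \<in> vertex_kernel D G z"
  have k': "k \<in> G" "k z = z" using k by (simp_all add: stabilizer_iff)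
  show "A.conj_by k h \<in> vertex_kernel D G z" using conj_by_kernel_sub[OF k'(1) z] h k'(2) by auto
qed

section \<open>Local transitivity and the semiprimitive alternative\<close>

definition locally_transitive :: "('a \<Rightarrow> 'a) set \<Rightarrow> 'a \<Rightarrow> bool" where
  "locally_transitive N z \<longleftrightarrow> (\<forall>u w. (z, u) \<in> parcs D \<longrightarrow> (z, w) \<in> parcs D \<longrightarrow> (\<exists>n\<in>N. n u = w))"

text \<open>Its image is the whole local action, so it sends normal subgroups of the stabiliser to
  normal subgroups of the local action, where semiprimitivity can be applied.\<close>

lemma restrict_neighbours_hom:
  assumes z: "z \<in> pverts D"
  shows "group_hom (A\<lparr>carrier := vertex_stabilizer D G z\<rparr>) (perm_group (neighbours D z) (local_action D G z))
    (\<lambda>g. restrict g (neighbours D z))"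
proof -
  let ?S = "vertex_stabilizer D G z" and ?N = "neighbours D z"
  have gS: "group (A\<lparr>carrier := ?S\<rparr>)" by (rule A.subgroup_imp_group[OF subgroup_stabilizer[OF z]])
  have mem: "g w \<in> ?N" if "g \<in> ?S" "w \<in> ?N" for g w
    using that arc_image[of g z w] by (simp add: stabilizer_iff)
  have Bij: "restrict g ?N \<in> Bij ?N" if g: "g \<in> ?S" for g
  proof -
    have ig: "inv\<^bsub>A\<^esub> g \<in> ?S" by (rule subgroup.m_inv_closed[OF subgroup_stabilizer[OF z] g])
    have gG: "g \<in> G" using g by (simp add: stabilizer_iff)
    have "bij_betw g ?N ?N"
      by (rule bij_betw_byWitness[where f' = "inv\<^bsub>A\<^esub> g"])
        (use mem[OF g] mem[OF ig] G_inv[OF gG] arc_verts(2) in auto)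
    then show ?thesis by (simp add: Bij_def)
  qed
  have hom: "(\<lambda>g. restrict g ?N) \<in> hom (A\<lparr>carrier := ?S\<rparr>) (BijGroup ?N)"
  proof (rule homI)
    fix g assume "g \<in> carrier (A\<lparr>carrier := ?S\<rparr>)"
    then show "restrict g ?N \<in> carrier (BijGroup ?N)" using Bij by (simp add: BijGroup_simps)
  next
    fix g h assume "g \<in> carrier (A\<lparr>carrier := ?S\<rparr>)" "h \<in> carrier (A\<lparr>carrier := ?S\<rparr>)"
    then have gh: "g \<in> ?S" "h \<in> ?S" by simp_all
    then have ghG: "g \<in> G" "h \<in> G" by (simp_all add: stabilizer_iff)
    have m: "restrict g ?N \<otimes>\<^bsub>BijGroup ?N\<^esub> restrict h ?N \<in> Bij ?N"
      using monoid.m_closed[OF group.is_monoid[OF group_BijGroup], of "restrict g ?N" ?N "restrict h ?N"]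
        Bij gh by (simp add: BijGroup_simps)
    have "restrict (g \<otimes>\<^bsub>A\<^esub> h) ?N = restrict g ?N \<otimes>\<^bsub>BijGroup ?N\<^esub> restrict h ?N"
    proof (rule Bij_eqI[OF Bij m])
      show "g \<otimes>\<^bsub>A\<^esub> h \<in> ?S" by (rule subgroup.m_closed[OF subgroup_stabilizer[OF z] gh])
      fix v assume v: "v \<in> ?N"
      then have "v \<in> pverts D" using arc_verts(2) by auto
      then show "restrict (g \<otimes>\<^bsub>A\<^esub> h) ?N v = (restrict g ?N \<otimes>\<^bsub>BijGroup ?N\<^esub> restrict h ?N) v"
        using G_mult[OF ghG] BijGroup_simps(2)[OF Bij[OF gh(1)] Bij[OF gh(2)] v] v mem[OF gh(2) v]
        by (simp del: neighbours_iff)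
    qed
    then show "restrict (g \<otimes>\<^bsub>A\<lparr>carrier := ?S\<rparr>\<^esub> h) ?N
        = restrict g ?N \<otimes>\<^bsub>BijGroup ?N\<^esub> restrict h ?N" by simp
  qed
  interpret h: group_hom "A\<lparr>carrier := ?S\<rparr>" "BijGroup ?N" "\<lambda>g. restrict g ?N"
    using gS hom by (simp add: group_hom_def group_hom_axioms_def group_BijGroup)
  have "subgroup (local_action D G z) (BijGroup ?N)"
    using h.img_is_subgroup by (simp add: local_action_def)
  then have "group (perm_group ?N (local_action D G z))"
    by (rule group.subgroup_imp_group[OF group_BijGroup])
  moreover have "(\<lambda>g. restrict g ?N) \<in> hom (A\<lparr>carrier := ?S\<rparr>) (perm_group ?N (local_action D G z))"
    using hom by (auto simp: hom_def local_action_def)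
  ultimately show ?thesis using gS by (simp add: group_hom_def group_hom_axioms_def)
qed

text \<open>The restriction of \<open>N\<close> to the neighbours is normal in the local action. If
  it is semiregular, an element of \<open>N\<close> fixing one neighbour restricts to the identity,
  which means that it lies in the kernel at \<open>z\<close>.\<close>

lemma semiprimitive_normal_cases:
  assumes z: "z \<in> pverts D" and sp: "semiprimitive_perm (neighbours D z) (local_action D G z)"
    and N: "A.normal_in N (vertex_stabilizer D G z)"
  shows "locally_transitive N z \<or> (\<forall>n\<in>N. \<forall>w. (z, w) \<in> parcs D \<longrightarrow> n w = w \<longrightarrow> n \<in> vertex_kernel D G z)"
proof -
  let ?S = "vertex_stabilizer D G z" and ?N = "neighbours D z"
  let ?r = "\<lambda>g. restrict g ?N"
  have "N \<lhd> A\<lparr>carrier := ?S\<rparr>"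
    using N A.normal_in_iff_normal[OF subgroup_stabilizer[OF z]] by simp
  then have "?r ` N \<lhd> perm_group ?N (local_action D G z)"
    by (rule normal.surj_hom_normal_subgroup[OF _ restrict_neighbours_hom[OF z]])
      (simp add: local_action_def)
  then consider "transitive_perm ?N (?r ` N)" | "semiregular_perm ?N (?r ` N)"
    using sp unfolding semiprimitive_perm_def by blast
  then show ?thesis
  proof cases
    case 1
    have "\<exists>n\<in>N. n u = w" if "(z, u) \<in> parcs D" "(z, w) \<in> parcs D" for u w
      using transitive_action.unique_orbit[OF 1[unfolded transitive_perm_def], of u w] that by auto
    then show ?thesis by (simp add: locally_transitive_def)
  next
    case 2
    have "n \<in> vertex_kernel D G z" if n: "n \<in> N" and w: "(z, w) \<in> parcs D" "n w = w" for n w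
    proof -
      have "\<exists>\<omega>\<in>?N. ?r n \<omega> = \<omega>" using w by (intro bexI[of _ w]) auto
      then have eq: "?r n = \<one>\<^bsub>BijGroup ?N\<^esub>" using 2 n unfolding semiregular_perm_def by blast
      have "n v = v" if "(z, v) \<in> parcs D" for v
      proof -
        have "?r n v = v" unfolding eq by (rule BijGroup_simps(3)) (use that in simp)
        then show ?thesis using that by simp
      qed
      moreover have "n \<in> ?S" using n A.normal_inD(3)[OF N] by blast
      ultimately show ?thesis by (simp add: kernel_iff stabilizer_iff)
    qed
    then show ?thesis by blast
  qed
qed

lemma fixes_all_imp_one:
  assumes "g \<in> G" "\<And>v. v \<in> pverts D \<Longrightarrow> g v = v"
  shows "g = \<one>\<^bsub>A\<^esub>"
  using assms A.one_closed G_one by (intro G_eqI) simp_all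

text \<open>Products of elements of \<open>N\<close> and \<open>M\<close> carry \<open>x\<close> or
  \<open>y\<close> to any vertex, by moving along a walk. Since \<open>S\<close> is invariant under
  these products and fixes \<open>x\<close> and \<open>y\<close>, it fixes every vertex.\<close>

lemma locally_transitive_edge_fixing:
  assumes xy: "(x, y) \<in> parcs D"
    and N: "A.normal_in N (vertex_stabilizer D G x)" "locally_transitive N x"
    and M: "A.normal_in M (vertex_stabilizer D G y)" "locally_transitive M y"
    and S: "S \<subseteq> vertex_stabilizer D G x \<inter> vertex_stabilizer D G y"
    and inv: "\<And>g s. g \<in> N \<union> M \<Longrightarrow> s \<in> S \<Longrightarrow> A.conj_by g s \<in> S"
  shows "S \<subseteq> {\<one>\<^bsub>A\<^esub>}"
proof
  fix s assume s: "s \<in> S"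
  note xyV = arc_verts[OF xy]
  \<comment> \<open>The inverse is there so that each \<open>s\<close> in \<open>S\<close> can be
    written as \<open>A.conj_by g s'\<close> with \<open>s'\<close> in \<open>S\<close>. Closure
    under products suffices below, so \<open>L\<close> is not shown to be a subgroup.\<close>
  define L where "L = {g \<in> G. \<forall>s\<in>S. A.conj_by (inv\<^bsub>A\<^esub> g) s \<in> S}"
  have SG: "S \<subseteq> G" using S by (auto simp: stabilizer_iff)
  have Lmult: "g \<otimes>\<^bsub>A\<^esub> h \<in> L" if "g \<in> L" "h \<in> L" for g h
  proof -
    have gh: "g \<in> G" "h \<in> G" "g \<otimes>\<^bsub>A\<^esub> h \<in> G" using that A.m_closed[of g h] by (auto simp: L_def)
    have "A.conj_by (inv\<^bsub>A\<^esub> (g \<otimes>\<^bsub>A\<^esub> h)) s \<in> S" if s: "s \<in> S" for s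
    proof -
      have "A.conj_by (inv\<^bsub>A\<^esub> (g \<otimes>\<^bsub>A\<^esub> h)) s = A.conj_by (inv\<^bsub>A\<^esub> h) (A.conj_by (inv\<^bsub>A\<^esub> g) s)"
        using A.inv_mult_group[of g h] A.conj_by_comp[of "inv\<^bsub>A\<^esub> h" "inv\<^bsub>A\<^esub> g" s]
          A.inv_closed[of g] A.inv_closed[of h] gh s SG by auto
      then show ?thesis using \<open>g \<in> L\<close> \<open>h \<in> L\<close> s by (simp add: L_def)
    qed
    then show ?thesis using gh by (simp add: L_def)
  qed
  have NL: "N \<subseteq> L" "M \<subseteq> L"
    using inv subgroup.m_inv_closed[OF A.normal_inD(1)[OF N(1)]] A.normal_inD(4)[OF N(1)]
      subgroup.m_inv_closed[OF A.normal_inD(1)[OF M(1)]] A.normal_inD(4)[OF M(1)]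
    by (auto simp: L_def)
  have orbit: "\<exists>g\<in>L. v = g x \<or> v = g y" if v: "v \<in> pverts D" for v
    using xyV(1) v
  proof (rule connected_induct)
    have "\<one>\<^bsub>A\<^esub> \<in> N" by (rule subgroup.one_closed[OF A.normal_inD(1)[OF N(1)]])
    then show "\<exists>g\<in>L. x = g x \<or> x = g y" using NL(1) G_one[OF xyV(1)] by (metis subsetD)
  next
    fix u w assume "\<exists>g\<in>L. u = g x \<or> u = g y" and uw: "(u, w) \<in> parcs D"
    then obtain g where g: "g \<in> L" "u = g x \<or> u = g y" by blast
    have gG: "g \<in> G" and ig: "inv\<^bsub>A\<^esub> g \<in> G" using g A.inv_closed[of g] by (auto simp: L_def)
    have w: "w \<in> pverts D" by (rule arc_verts(2)[OF uw])
    have iw: "((inv\<^bsub>A\<^esub> g) u, (inv\<^bsub>A\<^esub> g) w) \<in> parcs D" by (rule arc_image[OF ig uw])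
    from g(2) show "\<exists>g\<in>L. w = g x \<or> w = g y"
    proof
      \<comment> \<open>Pulled back by \<open>g\<close>, the next vertex of the walk is a neighbour
        of \<open>x\<close>, and \<open>N\<close> moves \<open>y\<close> there; the other case uses
        \<open>M\<close> at \<open>y\<close> in the same way.\<close>
      assume "u = g x"
      then have "(x, (inv\<^bsub>A\<^esub> g) w) \<in> parcs D" using iw G_inv(2)[OF gG xyV(1)] by simp
      then obtain n where n: "n \<in> N" "n y = (inv\<^bsub>A\<^esub> g) w"
        using N(2) xy unfolding locally_transitive_def by blast
      have "n \<in> G" using n NL by (auto simp: L_def)
      then have "(g \<otimes>\<^bsub>A\<^esub> n) y = w" using G_mult[OF gG _ xyV(2)] n(2) G_inv(1)[OF gG w] by simp
      then show ?thesis using Lmult[OF g(1)] n(1) NL(1) by blast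
    next
      assume "u = g y"
      then have "(y, (inv\<^bsub>A\<^esub> g) w) \<in> parcs D" using iw G_inv(2)[OF gG xyV(2)] by simp
      then obtain n where n: "n \<in> M" "n x = (inv\<^bsub>A\<^esub> g) w"
        using M(2) arc_sym[OF xy] unfolding locally_transitive_def by blast
      have "n \<in> G" using n NL by (auto simp: L_def)
      then have "(g \<otimes>\<^bsub>A\<^esub> n) x = w" using G_mult[OF gG _ xyV(1)] n(2) G_inv(1)[OF gG w] by simp
      then show ?thesis using Lmult[OF g(1)] n(1) NL(2) by blast
    qed
  qed
  have "s v = v" if v: "v \<in> pverts D" for v
  proof -
    obtain g where g: "g \<in> L" "v = g x \<or> v = g y" using orbit[OF v] by blast
    have gG: "g \<in> G" and ig: "inv\<^bsub>A\<^esub> g \<in> G" using g A.inv_closed[of g] by (auto simp: L_def)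
    define s' where "s' = A.conj_by (inv\<^bsub>A\<^esub> g) s"
    have s': "s' \<in> S" using g(1) s by (simp add: L_def s'_def)
    have "s = A.conj_by g s'" using A.conj_by_inv_cancel(1)[of g s] gG s SG by (auto simp: s'_def)
    then have "s (g u) = g (s' u)" if "u \<in> pverts D" for u
      using G_conj_by[OF gG _ that] s' SG by auto
    moreover have "s' x = x" "s' y = y" using s' S by (auto simp: stabilizer_iff)
    ultimately show ?thesis using g(2) xyV by auto
  qed
  then show "s \<in> {\<one>\<^bsub>A\<^esub>}" using fixes_all_imp_one s SG by blast
qed

lemma locally_transitive_image:
  assumes g: "g \<in> G" and z: "z \<in> pverts D" and tr: "locally_transitive (vertex_stabilizer D G z) z"
  shows "locally_transitive (vertex_stabilizer D G (g z)) (g z)"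
  unfolding locally_transitive_def
proof (intro allI impI)
  fix u w assume u: "(g z, u) \<in> parcs D" and w: "(g z, w) \<in> parcs D"
  have ig: "inv\<^bsub>A\<^esub> g \<in> G" using A.inv_closed[of g] g by simp
  let ?u = "(inv\<^bsub>A\<^esub> g) u" and ?w = "(inv\<^bsub>A\<^esub> g) w"
  have "(z, ?u) \<in> parcs D" "(z, ?w) \<in> parcs D"
    using arc_image[OF ig u] arc_image[OF ig w] G_inv(2)[OF g z] by simp_all
  then obtain n where n: "n \<in> vertex_stabilizer D G z" "n ?u = ?w"
    using tr unfolding locally_transitive_def by blast
  have "n \<in> G" using n(1) by (simp add: stabilizer_iff)
  then have "(A.conj_by g n) (g ?u) = g ?w"
    using G_conj_by[OF g _ G_mem[OF ig arc_verts(2)[OF u]]] n(2) by simp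
  then have "(A.conj_by g n) u = w"
    using G_inv(1)[OF g arc_verts(2)[OF u]] G_inv(1)[OF g arc_verts(2)[OF w]] by simp
  moreover have "A.conj_by g n \<in> vertex_stabilizer D G (g z)"
    using conj_by_stabilizer_sub[OF g z] n(1) by blast
  ultimately show "\<exists>n\<in>vertex_stabilizer D G (g z). n u = w" by blast
qed

text \<open>An element of the kernel at \<open>u\<close> fixes each neighbour \<open>w\<close> of
  \<open>u\<close> as well as \<open>u\<close>, so by \<open>reg\<close> it lies in the kernel at
  \<open>w\<close>. By connectedness it fixes every vertex.\<close>

lemma arc_kernel_trivial_if_locally_semiregular:
  assumes reg: "\<And>z w g. \<lbrakk>(z, w) \<in> parcs D; g \<in> vertex_stabilizer D G z; g w = w\<rbrakk> \<Longrightarrow> g \<in> vertex_kernel D G z"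
    and xy: "(x, y) \<in> parcs D"
  shows "arc_kernel D G x y = {\<one>\<^bsub>A\<^esub>}"
proof
  show "arc_kernel D G x y \<subseteq> {\<one>\<^bsub>A\<^esub>}"
  proof
    fix k assume k: "k \<in> arc_kernel D G x y"
    then have kG: "k \<in> G" by (simp add: arc_kernel_def kernel_iff)
    have "k \<in> vertex_kernel D G v" if v: "v \<in> pverts D" for v
      using arc_verts(1)[OF xy] v
    proof (rule connected_induct)
      show "k \<in> vertex_kernel D G x" using k by (simp add: arc_kernel_def)
      fix u w assume u: "k \<in> vertex_kernel D G u" "(u, w) \<in> parcs D"
      then have "k \<in> vertex_stabilizer D G w" "k u = u" by (auto simp: kernel_iff stabilizer_iff)
      then show "k \<in> vertex_kernel D G w" by (rule reg[OF arc_sym[OF u(2)]])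
    qed
    then show "k \<in> {\<one>\<^bsub>A\<^esub>}" using fixes_all_imp_one[OF kG] by (auto simp: kernel_iff)
  qed
  show "{\<one>\<^bsub>A\<^esub>} \<subseteq> arc_kernel D G x y"
    using subgroup.one_closed[OF subgroup_kernel[OF arc_verts(1)[OF xy]]]
      subgroup.one_closed[OF subgroup_kernel[OF arc_verts(2)[OF xy]]]
    unfolding arc_kernel_def by blast
qed

lemma semiprimitive_amalgam_arc:
  assumes sp: "locally_semiprimitive D G"
    and xy: "(x, y) \<in> parcs D"
    and tr: "locally_transitive (vertex_stabilizer D G x) x" "locally_transitive (vertex_stabilizer D G y) y"
    and t: "t \<in> G" "t x = y" "t y = x"
  shows "semiprimitive_amalgam A (vertex_stabilizer D G x) (vertex_stabilizer D G y)
    (vertex_kernel D G x) (vertex_kernel D G y) t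
    (\<lambda>N. locally_transitive N x) (\<lambda>N. locally_transitive N y)"
proof -
  note V = arc_verts[OF xy]
  \<comment> \<open>An element of \<open>N\<close> that fixes the neighbour \<open>w\<close> without
    lying in the kernel rules out the semiregular alternative. Both semiprimitivity assumptions of
    the locale follow, at \<open>x\<close> with \<open>w = y\<close> and at \<open>y\<close> with
    \<open>w = x\<close>.\<close>
  have cases: "locally_transitive N z"
    if zw: "(z, w) \<in> parcs D" and N: "A.normal_in N (vertex_stabilizer D G z)"
      "\<not> N \<inter> vertex_stabilizer D G w \<subseteq> vertex_kernel D G z" for N z w
  proof -
    have z: "z \<in> pverts D" by (rule arc_verts(1)[OF zw])
    obtain n where "n \<in> N" "n \<in> vertex_stabilizer D G w" "n \<notin> vertex_kernel D G z" using N(2) by blast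
    then have "\<exists>n\<in>N. n w = w \<and> n \<notin> vertex_kernel D G z" by (auto simp: stabilizer_iff)
    then show ?thesis
      using semiprimitive_normal_cases[OF z _ N(1)] sp z zw unfolding locally_semiprimitive_def by blast
  qed
  show ?thesis
  proof unfold_locales
    show "finite (carrier A)" using finite_G by simp
    show "A.normal_in (vertex_kernel D G x) (vertex_stabilizer D G x)"
      "A.normal_in (vertex_kernel D G y) (vertex_stabilizer D G y)"
      by (rule kernel_normal_in_stabilizer[OF V(1)], rule kernel_normal_in_stabilizer[OF V(2)])
    show "vertex_kernel D G x \<subseteq> vertex_stabilizer D G y" "vertex_kernel D G y \<subseteq> vertex_stabilizer D G x"
      using xy arc_sym[OF xy] by (auto simp: kernel_iff stabilizer_iff)
    show "t \<in> carrier A" using t by simp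
    show "A.conj_by t ` vertex_stabilizer D G x = vertex_stabilizer D G y"
      "A.conj_by t ` vertex_stabilizer D G y = vertex_stabilizer D G x"
      using conj_by_stabilizer[OF t(1) V(1)] conj_by_stabilizer[OF t(1) V(2)] t by simp_all
    show "A.conj_by t ` vertex_kernel D G x = vertex_kernel D G y"
      "A.conj_by t ` vertex_kernel D G y = vertex_kernel D G x"
      using conj_by_kernel[OF t(1) V(1)] conj_by_kernel[OF t(1) V(2)] t by simp_all
    show "locally_transitive (vertex_stabilizer D G x) x" "locally_transitive (vertex_stabilizer D G y) y"
      by (fact tr)+
    show "locally_transitive N x"
      if "A.normal_in N (vertex_stabilizer D G x)"
        "\<not> N \<inter> vertex_stabilizer D G y \<subseteq> vertex_kernel D G x" for N
      by (rule cases[OF xy that])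
    show "locally_transitive N y"
      if "A.normal_in N (vertex_stabilizer D G y)"
        "\<not> N \<inter> vertex_stabilizer D G x \<subseteq> vertex_kernel D G y" for N
      by (rule cases[OF arc_sym[OF xy] that])
    show "S \<subseteq> {\<one>\<^bsub>A\<^esub>}"
      if "A.normal_in N (vertex_stabilizer D G x)" "A.normal_in M (vertex_stabilizer D G y)"
        "locally_transitive N x" "locally_transitive M y"
        "S \<subseteq> vertex_stabilizer D G x \<inter> vertex_stabilizer D G y"
        "\<And>g s. g \<in> N \<union> M \<Longrightarrow> s \<in> S \<Longrightarrow> A.conj_by g s \<in> S" for N M S
      by (rule locally_transitive_edge_fixing[OF xy that(1,3,2,4,5,6)])
  qed
qed

end

section \<open>Conclusion for vertex-transitive, locally semiprimitive graphs\<close>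

theorem corollary3:
  fixes D :: "'a pair_pre_digraph" and G :: "('a \<Rightarrow> 'a) set" and x y :: 'a
  assumes "pair_graph D" and "Digraph_Component.connected (with_proj D)"
    and "subgroup G (graph_AutoGroup D)"
    and "vertex_transitive D G"
    and "locally_semiprimitive D G"
    and "(x, y) \<in> parcs D"
  shows "\<exists>p::nat. prime p \<and>
    p_group p (perm_group (pverts D) (arc_kernel D G x y)) \<and>
    (p_group p (perm_group (pverts D)
        (generalised_fitting_subgroup (perm_group (pverts D) (arc_stabilizer D G x y)))) \<or>
     arc_kernel D G x y = {\<one>\<^bsub>BijGroup (pverts D)\<^esub>})"
proof -
  interpret graph_automorphism_group D G
    by (rule graph_automorphism_group.intro[OF assms(1-3)])
  note V = arc_verts[OF assms(6)]
  show ?thesis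
  proof (cases "\<exists>z\<in>pverts D. locally_transitive (vertex_stabilizer D G z) z")
    case False
    \<comment> \<open>The stabiliser is a normal subgroup of itself. As it is nowhere locally
      transitive, the semiregular alternative holds for it at every vertex.\<close>
    have "g \<in> vertex_kernel D G z"
      if "(z, w) \<in> parcs D" "g \<in> vertex_stabilizer D G z" "g w = w" for z w g
      using semiprimitive_normal_cases[OF arc_verts(1)[OF that(1)] _
          A.normal_in_refl[OF subgroup_stabilizer[OF arc_verts(1)[OF that(1)]]]]
        assms(5) False that arc_verts(1)[OF that(1)] unfolding locally_semiprimitive_def by blast
    then have triv: "arc_kernel D G x y = {\<one>\<^bsub>A\<^esub>}"
      by (rule arc_kernel_trivial_if_locally_semiregular[OF _ assms(6)])
    have "p_group 2 (A\<lparr>carrier := {\<one>\<^bsub>A\<^esub>}\<rparr>)"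
      by (rule A.p_group_if_p_elements[OF _ A.triv_subgroup two_is_prime_nat])
        (use finite_G A.p_element_one in auto)
    then show ?thesis using triv two_is_prime_nat by (intro exI[of _ 2]) simp
  next
    case True
    then obtain z where z: "z \<in> pverts D" "locally_transitive (vertex_stabilizer D G z) z" by blast
    have ex: "\<exists>g\<in>G. g u = v" if "u \<in> pverts D" "v \<in> pverts D" for u v
      using transitive_action.unique_orbit[OF assms(4)[unfolded vertex_transitive_def transitive_perm_def] that]
      by simp
    \<comment> \<open>Vertex-transitivity spreads local transitivity from \<open>z\<close> to all
      vertices.\<close>
    have tr: "locally_transitive (vertex_stabilizer D G v) v" if "v \<in> pverts D" for v
      using ex[OF z(1) that] locally_transitive_image[OF _ z] by blast
    \<comment> \<open>An arc-reversing element is built in two moves: \<open>a\<close> takes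
      \<open>x\<close> to \<open>y\<close>, then \<open>h\<close> fixes \<open>y\<close> and takes
      the neighbour \<open>a y\<close> of \<open>y\<close> to \<open>x\<close>.\<close>
    obtain a where a: "a \<in> G" "a x = y" using ex[OF V] by blast
    then have "(y, a y) \<in> parcs D" using arc_image[OF a(1) assms(6)] by simp
    then obtain h where h: "h \<in> vertex_stabilizer D G y" "h (a y) = x"
      using tr[OF V(2)] arc_sym[OF assms(6)] unfolding locally_transitive_def by blast
    have h': "h \<in> G" "h y = y" using h(1) by (simp_all add: stabilizer_iff)
    let ?t = "h \<otimes>\<^bsub>A\<^esub> a"
    have t: "?t \<in> G" "?t x = y" "?t y = x"
      using A.m_closed[of h a] h' a G_mult[OF h'(1) a(1) V(1)] G_mult[OF h'(1) a(1) V(2)] h(2) by simp_all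
    show ?thesis
      using semiprimitive_amalgam.arc_kernel_cases[OF
          semiprimitive_amalgam_arc[OF assms(5,6) tr[OF V(1)] tr[OF V(2)] t]]
      by (simp add: arc_kernel_def arc_stabilizer_def)
  qed
qed

end
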